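(* Let $\varepsilon>0$ and consider points in Euclidean space $\mathbb{R}^d$ where distinct points have distance in $[1,\Delta]$. There is a deterministic expiration-streaming algorithm that stores $\mathcal{O}((1/\varepsilon)\log\Delta)$ words and maintains a $(1+\sqrt3+\varepsilon)$-approximation of the minimum enclosing ball of the active items: at any query time $t$ it outputs a ball (center $c\in\mathbb{R}^d$, radius $\rho$) containing all items active at time $t$ with $\rho\le(1+\sqrt3+\varepsilon)\rho^*$, where $\rho^*$ is the radius of the minimum enclosing ball of the active items.
   Context: Expiration streaming model: the input is a sequence of items; each item $x$ has a point $p(x)\in\mathbb{R}^d$, an integer insertion time $S(x)>0$ and expiration time $E(x)>S(x)$ (possibly $\infty$), insertion times non-decreasing along the stream. Item $x$ is active at time $t$ iff $S(x)\le t<E(x)$; queries at arbitrary times are evaluated on the active items. Space is measured in words, each storing a point of $\mathbb{R}^d$, a time, or a counter in $[\mathrm{poly}(n)]$. *)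

theory Defs
  imports "HOL-Analysis.Analysis" "HOL-Computational_Algebra.Polynomial" "HOL-Library.Extended_Nat"
begin

text \<open>
  The constants hidden in the space bound must not depend on the dimension, so \<open>d\<close> has to be a
  variable that can be quantified under an existential; it cannot be a type. A point of \<open>d\<close>-dimensional
  space is a function on the naturals that vanishes from index \<open>d\<close> on, as in
  \<^const>\<open>Euclidean_space\<close>. The metric that the library puts on function types is not the Euclidean
  one and is not used.
\<close>

type_synonym point = "nat \<Rightarrow> real"

definition space_R :: "nat \<Rightarrow> point set" where
  "space_R d = {x. \<forall>i\<ge>d. x i = 0}"

definition edist :: "nat \<Rightarrow> point \<Rightarrow> point \<Rightarrow> real" where
  "edist d x y = L2_set (\<lambda>i. x i - y i) {..<d}"

definition eball :: "nat \<Rightarrow> point \<Rightarrow> real \<Rightarrow> point set" where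
  "eball d c r = {x \<in> space_R d. edist d c x \<le> r}"

definition meb_radius :: "nat \<Rightarrow> point set \<Rightarrow> real" where
  "meb_radius d P = Inf {r. 0 \<le> r \<and> (\<exists>c \<in> space_R d. P \<subseteq> eball d c r)}"

datatype item = Item (pnt: point) (ins: nat) (expi: enat)

definition expiration_stream :: "nat \<Rightarrow> real \<Rightarrow> item list \<Rightarrow> bool" where
  "expiration_stream d \<Delta> xs \<longleftrightarrow>
     (\<forall>x \<in> set xs. pnt x \<in> space_R d \<and> 0 < ins x \<and> enat (ins x) < expi x) \<and>
     sorted (map ins xs) \<and>
     (\<forall>x \<in> set xs. \<forall>y \<in> set xs. pnt x \<noteq> pnt y \<longrightarrow>
        1 \<le> edist d (pnt x) (pnt y) \<and> edist d (pnt x) (pnt y) \<le> \<Delta>)"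

definition active_points :: "item list \<Rightarrow> nat \<Rightarrow> point set" where
  "active_points xs t = {pnt x | x. x \<in> set xs \<and> ins x \<le> t \<and> enat t < expi x}"

datatype word = Point point | Time enat | Counter nat

text \<open>
  A deterministic streaming algorithm. Its entire state between two items is a list of words, and
  the space used is the length of that list. A query reads the state and the query time.
\<close>

record stream_alg =
  initial :: "word list"
  update :: "word list \<Rightarrow> item \<Rightarrow> word list"
  query :: "word list \<Rightarrow> nat \<Rightarrow> point \<times> real"

definition state_after :: "stream_alg \<Rightarrow> item list \<Rightarrow> word list" where
  "state_after A xs = foldl (update A) (initial A) xs"

text \<open>
  An arbitrary real vector or an unbounded integer could encode the whole stream in one word, which
  would make every space bound vacuous. Hence a stored point or time has to be one that occurred in
  the part of the stream read so far, and counters are bounded by a polynomial in its length.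
\<close>

fun legal_word :: "nat poly \<Rightarrow> item list \<Rightarrow> word \<Rightarrow> bool" where
  "legal_word q xs (Point p) \<longleftrightarrow> (\<exists>x \<in> set xs. p = pnt x)"
| "legal_word q xs (Time s) \<longleftrightarrow> (\<exists>x \<in> set xs. s = enat (ins x) \<or> s = expi x)"
| "legal_word q xs (Counter k) \<longleftrightarrow> k \<le> poly q (length xs)"

text \<open>
  Every prefix of a stream is again a stream, so quantifying over all \<open>xs\<close> bounds the state at every
  moment of the computation.
\<close>

definition uses_space :: "nat \<Rightarrow> real \<Rightarrow> nat poly \<Rightarrow> stream_alg \<Rightarrow> real \<Rightarrow> bool" where
  "uses_space d \<Delta> q A s \<longleftrightarrow>
     (\<forall>xs. expiration_stream d \<Delta> xs \<longrightarrow>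
        (\<forall>w \<in> set (state_after A xs). legal_word q xs w) \<and> real (length (state_after A xs)) \<le> s)"

text \<open>
  A query at time \<open>t\<close> is posed to the state reached on some \<open>xs\<close> all of whose items have arrived by
  time \<open>t\<close>. If no item is active, the minimum enclosing ball does not exist and there is no
  condition on the size of the radius.
\<close>

definition maintains_meb :: "nat \<Rightarrow> real \<Rightarrow> stream_alg \<Rightarrow> real \<Rightarrow> bool" where
  "maintains_meb d \<Delta> A \<alpha> \<longleftrightarrow>
     (\<forall>xs t. expiration_stream d \<Delta> xs \<and> (\<forall>x \<in> set xs. ins x \<le> t) \<longrightarrow>
        (case query A (state_after A xs) t of (c, \<rho>) \<Rightarrow>
           c \<in> space_R d \<and> 0 \<le> \<rho> \<and>
           active_points xs t \<subseteq> eball d c \<rho> \<and>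
           (active_points xs t \<noteq> {} \<longrightarrow> \<rho> \<le> \<alpha> * meb_radius d (active_points xs t))))"

end

theory Submission imports Defs begin

text \<open>
  For each of the distances \<open>r = 0, 1, 1 + \<eta>, (1 + \<eta>)\<^sup>2, \<dots>\<close> a constant number of items is kept. Every new item
  is compared with them, and a pair at distance above \<open>r\<close> certifies the radius \<open>r / 2\<close> until one of
  the two expires; \<open>T\<close> is the last time certified in this way. A query at time \<open>t\<close> uses the least \<open>r\<close>
  with \<open>T \<le> t\<close>, so it suffices to cover the items active at \<open>t\<close> by a ball of radius \<open>(1 + \<surd>3) / 2 \<cdot> r\<close>.

  As long as the first item \<open>c\<^sub>0\<close> of a phase satisfies \<open>T < E(c\<^sub>0)\<close>, all items of the phase that are active
  after \<open>T\<close> lie within \<open>r\<close> of \<open>c\<^sub>0\<close>. Once \<open>T \<ge> E(c\<^sub>0)\<close>, the phase is frozen, and the next one starts with the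
  first item that outlives all items seen so far. When the frozen items outlive \<open>c\<^sub>0\<close>, the difficulty is
  that they are only known to be near the expired \<open>c\<^sub>0\<close>, while newer items are only known to be near an
  active stored item \<open>y\<close>. This is harmless if \<open>y\<close> is within \<open>(\<surd>3 - 1) r\<close> of \<open>c\<^sub>0\<close>: a ball around the
  midpoint then covers both sets. Therefore, within a phase, consider the items that expire later than
  all earlier ones. The first of them that is far from \<open>c\<^sub>0\<close> is kept as \<open>c\<^sub>1\<close> together with its predecessor
  \<open>y\<^sub>1\<close>, the first one far from both \<open>c\<^sub>0\<close> and \<open>c\<^sub>1\<close> is kept as \<open>c\<^sub>2\<close> together with its predecessor \<open>y\<^sub>2\<close>,
  and so on. From \<open>E(y\<^sub>i)\<close> to \<open>E(c\<^sub>i)\<close> the ball of radius \<open>r\<close> around \<open>c\<^sub>i\<close> works, because everything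
  active has been compared with \<open>c\<^sub>i\<close>; from \<open>E(c\<^sub>i\<^sub>-\<^sub>1)\<close> to \<open>E(y\<^sub>i)\<close> the midpoint argument applies to \<open>y\<^sub>i\<close>.
  After 16 such points one can stop: points within \<open>r\<close> of 16 points with pairwise distances above
  \<open>(\<surd>3 - 1) r\<close> lie within \<open>\<surd>3 / 2 \<cdot> r\<close> of the centroid, which leaves enough room for any \<open>y\<close>.
\<close>

section \<open>Euclidean estimates\<close>

lemma edist_nonneg: "0 \<le> edist d x y"
  by (simp add: edist_def)

lemma edist_self: "edist d x x = 0"
  by (simp add: edist_def L2_set_def)

lemma edist_commute: "edist d x y = edist d y x"
  by (simp add: edist_def L2_set_def power2_commute)

lemma edist_triangle: "edist d x z \<le> edist d x y + edist d y z"
proof -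
  have "edist d x z = L2_set (\<lambda>i. (x i - y i) + (y i - z i)) {..<d}"
    by (simp add: edist_def)
  also have "\<dots> \<le> edist d x y + edist d y z"
    unfolding edist_def by (rule L2_set_triangle_ineq)
  finally show ?thesis .
qed

lemma edist_sq: "(edist d x y)\<^sup>2 = (\<Sum>i<d. (x i - y i)\<^sup>2)"
  by (simp add: edist_def L2_set_def sum_nonneg)

definition mix :: "real \<Rightarrow> point \<Rightarrow> point \<Rightarrow> point" where
  "mix \<theta> a b = (\<lambda>i. a i + \<theta> * (b i - a i))"

lemma mix_in_space: "a \<in> space_R d \<Longrightarrow> b \<in> space_R d \<Longrightarrow> mix \<theta> a b \<in> space_R d"
  by (simp add: mix_def space_R_def)

lemma edist_mix_left:
  assumes "0 \<le> \<theta>"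
  shows "edist d (mix \<theta> a b) a = \<theta> * edist d a b"
proof -
  have "\<theta> * edist d b a = edist d (mix \<theta> a b) a"
    using assms unfolding edist_def by (simp add: L2_set_right_distrib mix_def)
  then show ?thesis by (simp add: edist_commute)
qed

lemma edist_mix_right:
  assumes "\<theta> \<le> 1"
  shows "edist d (mix \<theta> a b) b = (1 - \<theta>) * edist d a b"
proof -
  have "mix \<theta> a b = mix (1 - \<theta>) b a"
    by (simp add: mix_def algebra_simps)
  then show ?thesis
    using edist_mix_left[of "1 - \<theta>" d b a] assms by (simp add: edist_commute)
qed

text \<open>The point \<open>mix \<theta> a b\<close> cuts the segment into the fractions
  \<open>\<theta>\<close> and \<open>1 - \<theta>\<close>, so the triangle inequality through
  \<open>a\<close> or through \<open>b\<close> suffices. The alternative is chosen per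
  \<open>x\<close>, hence one centre serves a union of two balls.\<close>

lemma two_balls_cover:
  assumes "0 \<le> \<theta>" "\<theta> \<le> 1" "edist d a b \<le> D"
    and "edist d a x \<le> \<rho> \<and> \<rho> + \<theta> * D \<le> R \<or> edist d b x \<le> \<sigma> \<and> \<sigma> + (1 - \<theta>) * D \<le> R"
  shows "edist d (mix \<theta> a b) x \<le> R"
proof -
  have "edist d (mix \<theta> a b) x \<le> \<theta> * edist d a b + edist d a x"
    using edist_triangle[of d "mix \<theta> a b" x a] edist_mix_left[OF assms(1)] by simp
  moreover have "\<theta> * edist d a b \<le> \<theta> * D"
    using assms by (intro mult_left_mono)
  moreover have "edist d (mix \<theta> a b) x \<le> (1 - \<theta>) * edist d a b + edist d b x"
    using edist_triangle[of d "mix \<theta> a b" x b] edist_mix_right[OF assms(2)] by simp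
  moreover have "(1 - \<theta>) * edist d a b \<le> (1 - \<theta>) * D"
    using assms by (intro mult_left_mono) auto
  ultimately show ?thesis using assms(4) by linarith
qed

section \<open>Centroids of separated point sets\<close>

definition centroid :: "point set \<Rightarrow> point" where
  "centroid P = (\<lambda>i. (\<Sum>p\<in>P. p i) / card P)"

lemma centroid_in_space: "P \<subseteq> space_R d \<Longrightarrow> centroid P \<in> space_R d"
  by (auto simp: centroid_def space_R_def subset_iff intro!: sum.neutral)

text \<open>Steiner's parallel axis identity in one coordinate, multiplied by \<open>n\<close>, with
  the variance expressed by pairwise differences.\<close>

lemma sum_sq_deviation:
  fixes f :: "'a \<Rightarrow> real"
  assumes "finite P" "P \<noteq> {}"
  defines "n \<equiv> real (card P)"
  shows "n * (\<Sum>p\<in>P. (z - f p)\<^sup>2) =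
    n\<^sup>2 * (z - sum f P / n)\<^sup>2 + (\<Sum>p\<in>P. \<Sum>q\<in>P. (f p - f q)\<^sup>2) / 2"
proof -
  have n: "n \<noteq> 0" using assms by simp
  \<comment> \<open>Stated for every \<open>z\<close>: the instances \<open>z = f p\<close>, summed
    over \<open>p\<close>, also evaluate the double sum.\<close>
  have a: "(\<Sum>p\<in>P. (z - f p)\<^sup>2) = n * z\<^sup>2 - 2 * sum f P * z + (\<Sum>p\<in>P. (f p)\<^sup>2)" for z
    by (simp add: power2_diff sum.distrib sum_subtractf sum_distrib_left sum_distrib_right n_def
        algebra_simps)
  have "(\<Sum>p\<in>P. \<Sum>q\<in>P. (f p - f q)\<^sup>2) =
      (\<Sum>p\<in>P. n * (f p)\<^sup>2 - 2 * sum f P * f p + (\<Sum>p\<in>P. (f p)\<^sup>2))"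
    by (simp add: a)
  also have "\<dots> = 2 * n * (\<Sum>p\<in>P. (f p)\<^sup>2) - 2 * (sum f P)\<^sup>2"
    by (simp add: sum.distrib sum_subtractf sum_distrib_left[symmetric] n_def power2_eq_square)
  finally have b: "(\<Sum>p\<in>P. \<Sum>q\<in>P. (f p - f q)\<^sup>2) = \<dots>" .
  have c: "n\<^sup>2 * (z - sum f P / n)\<^sup>2 = (n * z - sum f P)\<^sup>2"
    using n by (simp add: power_mult_distrib[symmetric] right_diff_distrib)
  show ?thesis
    unfolding b a[of z] c by (simp add: power2_diff power2_eq_square field_simps)
qed

text \<open>The parallel axis identity is summed over the coordinates. Each of the
  \<open>n * (n - 1)\<close> ordered pairs of distinct points contributes at least
  \<open>s\<^sup>2\<close> to the variance, which is subtracted from the mean squared distance to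
  \<open>z\<close>.\<close>

lemma centroid_bound:
  assumes "finite P" "P \<noteq> {}" "0 \<le> s"
    and near: "\<And>p. p \<in> P \<Longrightarrow> edist d z p \<le> r"
    and sep: "\<And>p q. p \<in> P \<Longrightarrow> q \<in> P \<Longrightarrow> p \<noteq> q \<Longrightarrow> s \<le> edist d p q"
  defines "n \<equiv> real (card P)"
  shows "n * (edist d z (centroid P))\<^sup>2 \<le> n * r\<^sup>2 - (n - 1) * s\<^sup>2 / 2"
proof -
  have n: "n > 0" using assms by (simp add: card_gt_0_iff)
  have "n * (\<Sum>p\<in>P. (edist d z p)\<^sup>2) = (\<Sum>i<d. n * (\<Sum>p\<in>P. (z i - p i)\<^sup>2))"
    unfolding edist_sq sum_distrib_left[symmetric] by (subst sum.swap) simp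
  also have "\<dots> = (\<Sum>i<d. n\<^sup>2 * (z i - centroid P i)\<^sup>2 + (\<Sum>p\<in>P. \<Sum>q\<in>P. (p i - q i)\<^sup>2) / 2)"
    unfolding n_def centroid_def using assms(1,2) by (intro sum.cong refl sum_sq_deviation)
  also have "\<dots> = n\<^sup>2 * (edist d z (centroid P))\<^sup>2 + (\<Sum>i<d. \<Sum>p\<in>P. \<Sum>q\<in>P. (p i - q i)\<^sup>2) / 2"
    by (simp add: sum.distrib edist_sq sum_distrib_left sum_divide_distrib)
  also have "(\<Sum>i<d. \<Sum>p\<in>P. \<Sum>q\<in>P. (p i - q i)\<^sup>2) = (\<Sum>p\<in>P. \<Sum>q\<in>P. (edist d p q)\<^sup>2)"
    unfolding edist_sq by (subst sum.swap, subst (2) sum.swap) simp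
  finally have eq: "n * (\<Sum>p\<in>P. (edist d z p)\<^sup>2) =
      n\<^sup>2 * (edist d z (centroid P))\<^sup>2 + (\<Sum>p\<in>P. \<Sum>q\<in>P. (edist d p q)\<^sup>2) / 2" .
  have "(\<Sum>p\<in>P. (edist d z p)\<^sup>2) \<le> (\<Sum>p\<in>P. r\<^sup>2)"
    by (intro sum_mono power_mono near edist_nonneg)
  then have u: "n * (\<Sum>p\<in>P. (edist d z p)\<^sup>2) \<le> n * (n * r\<^sup>2)"
    using n by (intro mult_left_mono) (auto simp: n_def)
  have "(n - 1) * s\<^sup>2 \<le> (\<Sum>q\<in>P. (edist d p q)\<^sup>2)" if "p \<in> P" for p
  proof -
    have "(n - 1) * s\<^sup>2 = (\<Sum>q\<in>P - {p}. s\<^sup>2)"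
      using that assms(1,2) by (simp add: n_def card_Diff_singleton of_nat_diff Suc_leI card_gt_0_iff)
    also have "\<dots> \<le> (\<Sum>q\<in>P - {p}. (edist d p q)\<^sup>2)"
      using that \<open>0 \<le> s\<close> by (intro sum_mono power_mono sep) auto
    also have "\<dots> \<le> (\<Sum>q\<in>P. (edist d p q)\<^sup>2)"
      using assms(1) by (intro sum_mono2) auto
    finally show ?thesis .
  qed
  then have "(\<Sum>p\<in>P. (n - 1) * s\<^sup>2) \<le> (\<Sum>p\<in>P. \<Sum>q\<in>P. (edist d p q)\<^sup>2)"
    by (intro sum_mono) auto
  then have "n * ((n - 1) * s\<^sup>2) \<le> (\<Sum>p\<in>P. \<Sum>q\<in>P. (edist d p q)\<^sup>2)"
    by (simp add: n_def)
  with eq u have "n * (n * (edist d z (centroid P))\<^sup>2) \<le> n * (n * r\<^sup>2 - (n - 1) * s\<^sup>2 / 2)"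
    by (simp add: power2_eq_square field_simps)
  then show ?thesis using n by (simp only: mult_le_cancel_left_pos)
qed

lemma centroid_of_separated:
  assumes "card P = 16" "0 \<le> r"
    and "\<And>p. p \<in> P \<Longrightarrow> edist d z p \<le> r"
    and "\<And>p q. p \<in> P \<Longrightarrow> q \<in> P \<Longrightarrow> p \<noteq> q \<Longrightarrow> (sqrt 3 - 1) * r \<le> edist d p q"
  shows "edist d z (centroid P) \<le> sqrt 3 / 2 * r"
proof -
  have fin: "finite P" "P \<noteq> {}"
    using assms(1) card.infinite by fastforce+
  have "16 * (edist d z (centroid P))\<^sup>2 \<le> 16 * r\<^sup>2 - (16 - 1) * ((sqrt 3 - 1) * r)\<^sup>2 / 2"
    using centroid_bound[OF fin, of "(sqrt 3 - 1) * r" d z r] assms by simp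
  also have "\<dots> = (15 * sqrt 3 - 14) * r\<^sup>2"
    by (simp add: power_mult_distrib power2_diff power2_eq_square field_simps)
  also have "\<dots> \<le> 12 * r\<^sup>2"
  proof (rule mult_right_mono)
    \<comment> \<open>Here \<open>12 / 16\<close> is the square of \<open>sqrt 3 / 2\<close>, so
      exactly \<open>15 * sqrt 3 \<le> 26\<close> is required; it holds because 676/225 exceeds
      3.\<close>
    have "sqrt 3 \<le> 26 / 15" by (rule real_le_lsqrt) (auto simp: power2_eq_square)
    then show "15 * sqrt 3 - 14 \<le> 12" by simp
  qed simp
  also have "\<dots> = 16 * (sqrt 3 / 2 * r)\<^sup>2"
    by (simp add: power_mult_distrib power_divide)
  finally show ?thesis
    using assms(2) by (intro power2_le_imp_le[where x = "edist d z (centroid P)"]) auto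
qed


section \<open>One distance scale\<close>

text \<open>
  A stored point carries its expiration time. A chain \<open>(ns, q)\<close> is one phase: \<open>q\<close> is its latest-expiring
  item and \<open>ns\<close> lists the pairs \<open>(c\<^sub>i, y\<^sub>i)\<close>, newest first, with \<open>(c\<^sub>0, c\<^sub>0)\<close> at the end. A level \<open>(T, F, G)\<close>
  consists of the certified time, the frozen phase and the current phase.
\<close>

type_synonym spoint = "point \<times> enat"
type_synonym chain = "(spoint \<times> spoint) list \<times> spoint"
type_synonym level = "enat \<times> chain option \<times> chain option"

text \<open>A distance above \<open>r\<close> is excused only by an expiration up to
  \<open>T\<close>, and this scale answers queries only from \<open>T\<close> on.\<close>

definition compatible :: "nat \<Rightarrow> real \<Rightarrow> enat \<Rightarrow> spoint \<Rightarrow> spoint \<Rightarrow> bool" where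
  "compatible d r T a x \<longleftrightarrow> edist d (fst a) (fst x) \<le> r \<or> min (snd a) (snd x) \<le> T"

text \<open>At this threshold the midpoint of \<open>y\<close> and the node is within
  \<open>(sqrt 3 - 1) / 2 * r\<close> of both, so balls of radius \<open>r\<close> around them fit
  into one of radius \<open>(1 + sqrt 3) / 2 * r\<close>.\<close>

definition linked :: "nat \<Rightarrow> real \<Rightarrow> spoint \<Rightarrow> (spoint \<times> spoint) list \<Rightarrow> bool" where
  "linked d r y ns \<longleftrightarrow> (\<exists>n\<in>set ns. edist d (fst y) (fst (fst n)) \<le> (sqrt 3 - 1) * r)"

text \<open>The tail \<open>ns\<close> is itself a chain with latest item \<open>y\<close>, which is
  what \<open>chain_cover\<close> recurses on. The item \<open>q\<close> enters only through its
  expiration, so a later-expiring one can replace it.\<close>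

inductive is_chain :: "nat \<Rightarrow> real \<Rightarrow> (spoint \<times> spoint) list \<Rightarrow> spoint \<Rightarrow> bool" for d r where
  base: "snd c \<le> snd q \<Longrightarrow> is_chain d r [(c, c)] q"
| step: "is_chain d r ns y \<Longrightarrow> linked d r y ns \<Longrightarrow> \<not> linked d r c ns \<Longrightarrow>
    snd y < snd c \<Longrightarrow> snd c \<le> snd q \<Longrightarrow> is_chain d r ((c, y) # ns) q"

abbreviation origin :: "(spoint \<times> spoint) list \<Rightarrow> spoint" where
  "origin ns \<equiv> fst (last ns)"

text \<open>With fewer than 16 nodes an unlinked latest item would have become a node
  itself.\<close>

definition full_chain :: "nat \<Rightarrow> real \<Rightarrow> (spoint \<times> spoint) list \<Rightarrow> spoint \<Rightarrow> bool" where
  "full_chain d r ns q \<longleftrightarrow> is_chain d r ns q \<and> length ns \<le> 16 \<and> (length ns < 16 \<longrightarrow> linked d r q ns)"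

text \<open>
  \<open>before\<close> and \<open>after\<close> say what is known about an item that arrived before, respectively after, the
  chain was frozen. No arrival order has to be recorded: only items that arrived after \<open>y\<close> can expire
  later than \<open>y\<close>, if \<open>y\<close> was the latest-expiring item at its time.
\<close>

definition before :: "nat \<Rightarrow> real \<Rightarrow> enat \<Rightarrow> (spoint \<times> spoint) list \<Rightarrow> spoint \<Rightarrow> bool" where
  "before d r T ns x \<longleftrightarrow>
     (\<forall>(c, y)\<in>set ns. snd y < snd x \<and> T < snd x \<longrightarrow> edist d (fst c) (fst x) \<le> r)"

definition after :: "nat \<Rightarrow> real \<Rightarrow> enat \<Rightarrow> (spoint \<times> spoint) list \<Rightarrow> spoint \<Rightarrow> spoint \<Rightarrow> bool" where
  "after d r T ns q x \<longleftrightarrow> (\<forall>y\<in>insert q (snd ` set ns). compatible d r T y x)"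

text \<open>Items that outlive \<open>y\<close> arrived after it, hence not before \<open>c\<close>,
  and were compared with the stored \<open>c\<close>. This holds before and after freezing.\<close>

definition tested :: "nat \<Rightarrow> real \<Rightarrow> enat \<Rightarrow> (spoint \<times> spoint) list \<Rightarrow> spoint \<Rightarrow> bool" where
  "tested d r T ns x \<longleftrightarrow> (\<forall>(c, y)\<in>set ns. snd y < snd x \<longrightarrow> compatible d r T c x)"

section \<open>Order and separation within a chain\<close>

lemma is_chain_nonempty: "is_chain d r ns q \<Longrightarrow> ns \<noteq> []"
  by (induction rule: is_chain.induct) auto

lemma is_chain_mono: "is_chain d r ns q \<Longrightarrow> snd q \<le> snd q' \<Longrightarrow> is_chain d r ns q'"
  by (erule is_chain.cases) (auto intro: is_chain.intros)

lemma is_chain_bounds: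
  assumes "is_chain d r ns q" "(c, y) \<in> set ns"
  shows "snd (origin ns) \<le> snd c" "snd y \<le> snd c" "snd c \<le> snd q"
proof -
  have "\<forall>(c, y)\<in>set ns. snd (origin ns) \<le> snd c \<and> snd y \<le> snd c \<and> snd c \<le> snd q"
    using assms(1)
  proof (induction rule: is_chain.induct)
    case (step ns y c q)
    have ne: "ns \<noteq> []" using step.hyps(1) by (rule is_chain_nonempty)
    then obtain y' where "(origin ns, y') \<in> set ns" by (metis last_in_set prod.collapse)
    with step.IH have "snd (origin ns) \<le> snd y" by auto
    with step.hyps have le: "snd (origin ns) \<le> snd c" "snd y \<le> snd c" "snd y \<le> snd q"
      by (meson order_trans less_imp_le)+
    have tl: "snd (origin ns) \<le> snd a \<and> snd b \<le> snd a \<and> snd a \<le> snd q" if "(a, b) \<in> set ns" for a b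
    proof -
      have "snd (origin ns) \<le> snd a \<and> snd b \<le> snd a \<and> snd a \<le> snd y" using step.IH that by blast
      with le(3) show ?thesis by (blast intro: order_trans)
    qed
    have origin: "origin ((c, y) # ns) = origin ns" using ne by simp
    show ?case
      unfolding origin
    proof (rule ballI, rule case_prodI2)
      fix n a b assume "n \<in> set ((c, y) # ns)" and n: "n = (a, b)"
      then consider "a = c" "b = y" | "(a, b) \<in> set ns" by auto
      then show "snd (origin ns) \<le> snd a \<and> snd b \<le> snd a \<and> snd a \<le> snd q"
        using tl le step.hyps(5) by cases blast+
    qed
  qed simp
  with assms(2) show "snd (origin ns) \<le> snd c" "snd y \<le> snd c" "snd c \<le> snd q" by auto
qed

lemma origin_in: "is_chain d r ns q \<Longrightarrow> \<exists>y. (origin ns, y) \<in> set ns"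
  by (metis is_chain_nonempty last_in_set prod.collapse)

text \<open>A new node is not linked to the older ones, so its distance to them strictly exceeds a
  nonnegative threshold; in particular its point is new.\<close>

lemma is_chain_card:
  assumes "is_chain d r ns q" "0 \<le> r"
  defines "P \<equiv> (\<lambda>n. fst (fst n)) ` set ns"
  shows "card P = length ns"
    and "\<And>p p'. p \<in> P \<Longrightarrow> p' \<in> P \<Longrightarrow> p \<noteq> p' \<Longrightarrow> (sqrt 3 - 1) * r \<le> edist d p p'"
proof -
  have "card ((\<lambda>n. fst (fst n)) ` set ns) = length ns \<and>
    (\<forall>p\<in>(\<lambda>n. fst (fst n)) ` set ns. \<forall>p'\<in>(\<lambda>n. fst (fst n)) ` set ns.
       p \<noteq> p' \<longrightarrow> (sqrt 3 - 1) * r \<le> edist d p p')"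
    using assms(1)
  proof (induction rule: is_chain.induct)
    case (step ns y c q)
    have far: "(sqrt 3 - 1) * r < edist d (fst c) (fst (fst n))" if "n \<in> set ns" for n
      using step.hyps(3) that by (auto simp: linked_def not_le)
    have "fst c \<notin> (\<lambda>n. fst (fst n)) ` set ns"
    proof
      assume "fst c \<in> (\<lambda>n. fst (fst n)) ` set ns"
      then obtain n where "n \<in> set ns" "fst c = fst (fst n)" by auto
      with far[of n] have "(sqrt 3 - 1) * r < 0" by (simp add: edist_self)
      moreover have "0 \<le> (sqrt 3 - 1) * r" using assms(2) by simp
      ultimately show False by simp
    qed
    moreover have "(sqrt 3 - 1) * r \<le> edist d (fst c) p \<and> (sqrt 3 - 1) * r \<le> edist d p (fst c)"
      if "p \<in> (\<lambda>n. fst (fst n)) ` set ns" for p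
      using that far edist_commute[of d p "fst c"] by (auto intro: less_imp_le)
    ultimately show ?case using step.IH by simp
  qed auto
  then show "card P = length ns"
    and "\<And>p p'. p \<in> P \<Longrightarrow> p' \<in> P \<Longrightarrow> p \<noteq> p' \<Longrightarrow> (sqrt 3 - 1) * r \<le> edist d p p'"
    unfolding P_def by blast+
qed

section \<open>Covering the active items of a frozen chain\<close>

abbreviation cover_radius :: "real \<Rightarrow> real" where
  "cover_radius r \<equiv> (1 + sqrt 3) / 2 * r"

lemma le_radius: "0 \<le> r \<Longrightarrow> r \<le> cover_radius r"
proof -
  assume "0 \<le> r"
  then have "1 * r \<le> cover_radius r" by (intro mult_right_mono) auto
  then show ?thesis by simp
qed

lemma compatibleD:
  "compatible d r T a x \<Longrightarrow> T \<le> t \<Longrightarrow> t < snd a \<Longrightarrow> t < snd x \<Longrightarrow> edist d (fst a) (fst x) \<le> r"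
  by (auto simp: compatible_def min_def split: if_splits)

text \<open>All nodes have expired by \<open>t\<close>, so an active item with \<open>before\<close>
  is within \<open>r\<close> of every node, in particular of the one linked to \<open>q\<close>, and
  any other active item is within \<open>r\<close> of the active \<open>q\<close>. The midpoint of
  that node and \<open>q\<close> serves both.\<close>

lemma linked_cover:
  assumes "is_chain d r ns q" "linked d r q ns" "0 \<le> r"
    and "\<And>c y. (c, y) \<in> set ns \<Longrightarrow> snd c \<le> t" "t < snd q" "T \<le> t"
    and "fst q \<in> space_R d" "\<And>c y. (c, y) \<in> set ns \<Longrightarrow> fst c \<in> space_R d"
  shows "\<exists>p\<in>space_R d. \<forall>x. (before d r T ns x \<or> compatible d r T q x) \<and> t < snd x \<longrightarrow>
    edist d p (fst x) \<le> cover_radius r"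
proof -
  obtain c y where c: "(c, y) \<in> set ns" "edist d (fst c) (fst q) \<le> (sqrt 3 - 1) * r"
    using assms(2) by (auto simp: linked_def edist_commute)
  let ?p = "mix (1/2) (fst c) (fst q)"
  have "edist d ?p (fst x) \<le> cover_radius r"
    if x: "before d r T ns x \<or> compatible d r T q x" "t < snd x" for x
  proof (rule two_balls_cover[OF _ _ c(2), of _ _ r _ r])
    have "edist d (fst c) (fst x) \<le> r" if "before d r T ns x"
    proof -
      have "snd y \<le> snd c" using is_chain_bounds[OF assms(1) c(1)] by simp
      also have "snd c \<le> t" using assms(4) c(1) by blast
      finally show ?thesis using that x(2) c(1) assms(6) unfolding before_def by fastforce
    qed
    moreover have "edist d (fst q) (fst x) \<le> r" if "compatible d r T q x"
      using compatibleD[OF that assms(6,5) x(2)] .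
    ultimately show "edist d (fst c) (fst x) \<le> r \<and> r + 1 / 2 * ((sqrt 3 - 1) * r) \<le> cover_radius r \<or>
      edist d (fst q) (fst x) \<le> r \<and> r + (1 - 1 / 2) * ((sqrt 3 - 1) * r) \<le> cover_radius r"
      using x(1) by (auto simp: field_simps)
  qed auto
  moreover have "?p \<in> space_R d" using assms c by (intro mix_in_space)
  ultimately show ?thesis by blast
qed

text \<open>The centroid of the 16 nodes replaces the linked node. Since \<open>q\<close> satisfies
  \<open>before\<close> too, it is itself within \<open>sqrt 3 / 2 * r\<close> of the
  centroid.\<close>

lemma separated_cover:
  assumes "is_chain d r ns q" "length ns = 16" "0 \<le> r"
    and "\<And>c y. (c, y) \<in> set ns \<Longrightarrow> snd c \<le> t" "t < snd q" "T \<le> t"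
    and "fst q \<in> space_R d" "\<And>c y. (c, y) \<in> set ns \<Longrightarrow> fst c \<in> space_R d"
    and "before d r T ns q"
  shows "\<exists>p\<in>space_R d. \<forall>x. (before d r T ns x \<or> compatible d r T q x) \<and> t < snd x \<longrightarrow>
    edist d p (fst x) \<le> cover_radius r"
proof -
  define P where "P = (\<lambda>n. fst (fst n)) ` set ns"
  have near: "edist d (centroid P) (fst x) \<le> sqrt 3 / 2 * r" if x: "before d r T ns x" "t < snd x" for x
  proof -
    have "edist d (fst x) p \<le> r" if "p \<in> P" for p
    proof -
      obtain c y where c: "(c, y) \<in> set ns" "p = fst c" using \<open>p \<in> P\<close> by (auto simp: P_def)
      have "snd y \<le> snd c" using is_chain_bounds[OF assms(1) c(1)] by simp
      also have "snd c \<le> t" using assms(4) c(1) by blast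
      finally have "edist d (fst c) (fst x) \<le> r"
        using x c(1) assms(6) unfolding before_def by fastforce
      then show ?thesis by (simp add: c edist_commute)
    qed
    then have "edist d (fst x) (centroid P) \<le> sqrt 3 / 2 * r"
      using is_chain_card[OF assms(1,3)] assms(2,3)
      by (intro centroid_of_separated) (auto simp: P_def)
    then show ?thesis by (simp add: edist_commute)
  qed
  \<comment> \<open>The fraction \<open>1 / sqrt 3\<close> balances the two radii: moving by
    \<open>r / 2\<close> from the centroid leaves \<open>(sqrt 3 - 1) / 2 * r\<close> to
    \<open>q\<close>, so both balls reach exactly \<open>cover_radius r\<close>.\<close>
  let ?p = "mix (1 / sqrt 3) (centroid P) (fst q)"
  have "edist d ?p (fst x) \<le> cover_radius r"
    if x: "before d r T ns x \<or> compatible d r T q x" "t < snd x" for x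
  proof (rule two_balls_cover[OF _ _ near[OF assms(9,5)], of _ _ "sqrt 3 / 2 * r" _ r])
    have "edist d (fst q) (fst x) \<le> r" if "compatible d r T q x"
      using compatibleD[OF that assms(6,5) x(2)] .
    moreover have "sqrt 3 / 2 * r + 1 / sqrt 3 * (sqrt 3 / 2 * r) = cover_radius r"
      by (simp add: field_simps)
    moreover have "r + (1 - 1 / sqrt 3) * (sqrt 3 / 2 * r) = cover_radius r"
      by (simp add: field_simps)
    ultimately show "edist d (centroid P) (fst x) \<le> sqrt 3 / 2 * r \<and>
        sqrt 3 / 2 * r + 1 / sqrt 3 * (sqrt 3 / 2 * r) \<le> cover_radius r \<or>
      edist d (fst q) (fst x) \<le> r \<and> r + (1 - 1 / sqrt 3) * (sqrt 3 / 2 * r) \<le> cover_radius r"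
      using x near[of x] by auto
  qed auto
  moreover have "?p \<in> space_R d"
    using assms by (intro mix_in_space centroid_in_space) (auto simp: P_def)
  ultimately show ?thesis by blast
qed

text \<open>The newest node \<open>c\<close> with predecessor \<open>y\<close> splits the time axis:
  after \<open>c\<close> has expired a ball near \<open>q\<close> works, between the expirations of
  \<open>y\<close> and \<open>c\<close> the point \<open>c\<close> is a centre, and before that the
  tail of the chain decides.\<close>

lemma chain_cover:
  assumes "is_chain d r ns q" "linked d r q ns \<or> length ns = 16 \<and> before d r T ns q" "0 \<le> r"
    and "snd (origin ns) \<le> t" "t < snd q" "T \<le> t"
    and "fst q \<in> space_R d" "\<And>c y. (c, y) \<in> set ns \<Longrightarrow> fst c \<in> space_R d \<and> fst y \<in> space_R d"
  shows "\<exists>p\<in>space_R d. \<forall>x. (before d r T ns x \<or> after d r T ns q x) \<and> tested d r T ns x \<and> t < snd x \<longrightarrow>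
    edist d p (fst x) \<le> cover_radius r"
  using assms
proof (induction rule: is_chain.induct)
  case (base c q)
  have ch: "is_chain d r [(c, c)] q" using base.hyps by (rule is_chain.base)
  have "\<exists>p\<in>space_R d. \<forall>x. (before d r T [(c, c)] x \<or> compatible d r T q x) \<and> t < snd x \<longrightarrow>
    edist d p (fst x) \<le> cover_radius r"
    using base.prems by (intro linked_cover[OF ch]) auto
  then show ?case by (auto simp: after_def)
next
  case (step ns y c q)
  have ch: "is_chain d r ((c, y) # ns) q" using step.hyps by (rule is_chain.step)
  have ne: "ns \<noteq> []" using step.hyps(1) by (rule is_chain_nonempty)
  consider "snd c \<le> t" | "t < snd c" "snd y \<le> t" | "t < snd y" by fastforce
  then show ?case
  proof cases
    case 1
    have le: "snd c' \<le> t" if "(c', y') \<in> set ((c, y) # ns)" for c' y'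
    proof (cases "(c', y') = (c, y)")
      case False
      then have "snd c' \<le> snd y" using that is_chain_bounds(3)[OF step.hyps(1), of c' y'] by auto
      with step.hyps(4) 1 show ?thesis by simp
    qed (use 1 in simp)
    have "\<exists>p\<in>space_R d. \<forall>x. (before d r T ((c, y) # ns) x \<or> compatible d r T q x) \<and> t < snd x \<longrightarrow>
      edist d p (fst x) \<le> cover_radius r"
      using step.prems(1)
    proof
      assume "linked d r q ((c, y) # ns)"
      then show ?thesis
        by (rule linked_cover[OF ch]) (use step.prems(2-7) le in blast)+
    next
      assume full: "length ((c, y) # ns) = 16 \<and> before d r T ((c, y) # ns) q"
      show ?thesis
        by (rule separated_cover[OF ch]) (use step.prems(2-7) full le in blast)+
    qed
    moreover have "compatible d r T q x" if "after d r T ((c, y) # ns) q x" for x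
      using that by (simp add: after_def)
    ultimately show ?thesis by meson
  next
    case 2
    have "edist d (fst c) (fst x) \<le> cover_radius r" if "tested d r T ((c, y) # ns) x" "t < snd x" for x
    proof -
      have "compatible d r T c x" using that 2 by (auto simp: tested_def)
      then have "edist d (fst c) (fst x) \<le> r"
        using compatibleD step.prems(5) 2(1) that(2) by blast
      then show ?thesis using le_radius[OF step.prems(2)] by simp
    qed
    then show ?thesis using step.prems(7)[of c y] by (intro bexI[of _ "fst c"]) auto
  next
    case 3
    \<comment> \<open>Now \<open>y\<close> takes the role of \<open>q\<close>: it is active, linked
      to \<open>ns\<close>, and among the points that \<open>after\<close> refers to.\<close>
    have "\<exists>p\<in>space_R d. \<forall>x. (before d r T ns x \<or> after d r T ns y x) \<and> tested d r T ns x \<and>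
        t < snd x \<longrightarrow> edist d p (fst x) \<le> cover_radius r"
    proof (rule step.IH)
      show "snd (origin ns) \<le> t" using step.prems(3) ne by simp
      show "fst y \<in> space_R d" using step.prems(7)[of c y] by simp
      show "\<And>c y. (c, y) \<in> set ns \<Longrightarrow> fst c \<in> space_R d \<and> fst y \<in> space_R d"
        using step.prems(7) by auto
    qed (use step 3 in auto)
    moreover have "before d r T ns x" if "before d r T ((c, y) # ns) x" for x
      using that by (simp add: before_def)
    moreover have "after d r T ns y x" if "after d r T ((c, y) # ns) q x" for x
      using that by (simp add: after_def)
    moreover have "tested d r T ns x" if "tested d r T ((c, y) # ns) x" for x
      using that by (simp add: tested_def)
    ultimately show ?thesis by meson
  qed
qed


section \<open>Levels and their invariant\<close>

fun frontier :: "chain option \<Rightarrow> enat" where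
  "frontier None = 0"
| "frontier (Some (ns, q)) = snd q"

definition chain_points :: "chain \<Rightarrow> spoint set" where
  "chain_points c = insert (snd c) (fst ` set (fst c) \<union> snd ` set (fst c))"

definition stored :: "level \<Rightarrow> spoint set" where
  "stored s = (\<Union>c\<in>set_option (fst (snd s)) \<union> set_option (snd (snd s)). chain_points c)"

lemma in_chain_points: "(c, y) \<in> set ns \<Longrightarrow> c \<in> chain_points (ns, q)" "(c, y) \<in> set ns \<Longrightarrow> y \<in> chain_points (ns, q)"
  "q \<in> chain_points (ns, q)"
  by (force simp: chain_points_def)+

lemma chain_points_stored: "chain_points c \<subseteq> stored (T, Some c, G)" "chain_points c \<subseteq> stored (T, F, Some c)"
  by (auto simp: stored_def)

fun sound_level :: "nat \<Rightarrow> real \<Rightarrow> level \<Rightarrow> bool" where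
  "sound_level d r (T, F, G) \<longleftrightarrow>
     (\<forall>(ns, q)\<in>set_option F. full_chain d r ns q \<and> snd (origin ns) \<le> T \<and> before d r T ns q) \<and>
     (\<forall>(ns, m)\<in>set_option G. full_chain d r ns m \<and> T < snd (origin ns) \<and> frontier F < snd (origin ns))"

fun handles :: "nat \<Rightarrow> real \<Rightarrow> level \<Rightarrow> spoint \<Rightarrow> bool" where
  "handles d r (T, F, G) x \<longleftrightarrow>
     (\<forall>(ns, q)\<in>set_option F. (before d r T ns x \<or> after d r T ns q x) \<and> tested d r T ns x) \<and>
     (\<forall>(ns, m)\<in>set_option G. snd x \<le> snd m \<and> tested d r T ns x \<and>
        (frontier F < snd x \<longrightarrow> compatible d r T (origin ns) x)) \<and>
     (G = None \<longrightarrow> snd x \<le> frontier F)"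

text \<open>At any query time before \<open>T\<close> both witnesses are active, which forces a
  radius above \<open>r / 2\<close>. Apart from the initial 0, \<open>T\<close> is an expiration
  from the stream and thus a legal word.\<close>

definition certified :: "nat \<Rightarrow> real \<Rightarrow> spoint set \<Rightarrow> enat \<Rightarrow> bool" where
  "certified d r X T \<longleftrightarrow> T = 0 \<or> T \<in> snd ` X \<and>
     (\<exists>a\<in>X. \<exists>b\<in>X. T \<le> snd a \<and> T \<le> snd b \<and> r < edist d (fst a) (fst b))"

definition level_inv :: "nat \<Rightarrow> real \<Rightarrow> spoint set \<Rightarrow> level \<Rightarrow> bool" where
  "level_inv d r X s \<longleftrightarrow> sound_level d r s \<and> (\<forall>x\<in>X. handles d r s x) \<and> stored s \<subseteq> X \<and>
     certified d r X (fst s)"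

definition raised :: "nat \<Rightarrow> real \<Rightarrow> spoint set \<Rightarrow> enat \<Rightarrow> spoint \<Rightarrow> enat" where
  "raised d r S T x = Max (insert T ((\<lambda>y. min (snd x) (snd y)) ` {y\<in>S. r < edist d (fst y) (fst x)}))"

text \<open>The comparison with all stored points comes first, so \<open>T'\<close> already accounts
  for \<open>x\<close> when the phases change.\<close>

definition level_step :: "nat \<Rightarrow> real \<Rightarrow> level \<Rightarrow> spoint \<Rightarrow> level" where
  "level_step d r s x =
    (case s of (T, F, G) \<Rightarrow> let T' = raised d r (stored s) T x in
      case G of
        None \<Rightarrow> (T', F, if snd x \<le> frontier F then None else Some ([(x, x)], x))
      | Some (ns, m) \<Rightarrow>
          if snd (origin ns) \<le> T' then (T', G, if snd x \<le> snd m then None else Some ([(x, x)], x))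
          else if snd x \<le> snd m then (T', F, G)
          else if length ns < 16 \<and> \<not> linked d r x ns then (T', F, Some ((x, m) # ns, x))
          else (T', F, Some (ns, x)))"

lemma level_cover:
  assumes "sound_level d r s" "0 \<le> r" "fst s \<le> t" and space: "\<And>p. p \<in> stored s \<Longrightarrow> fst p \<in> space_R d"
  shows "\<exists>p\<in>space_R d. \<forall>x. handles d r s x \<and> t < snd x \<longrightarrow> edist d p (fst x) \<le> cover_radius r"
proof -
  obtain T F G where s: "s = (T, F, G)" by (cases s)
  consider (F) ns q where "F = Some (ns, q)" "t < snd q"
    | (G) ns m where "frontier F \<le> t" "G = Some (ns, m)" | (none) "frontier F \<le> t" "G = None"
    by (cases "frontier F \<le> t"; cases F; cases G) (auto simp: not_le)
  then show ?thesis
  proof cases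
    case F
    have "\<exists>p\<in>space_R d. \<forall>x. (before d r T ns x \<or> after d r T ns q x) \<and> tested d r T ns x \<and>
        t < snd x \<longrightarrow> edist d p (fst x) \<le> cover_radius r"
    proof (rule chain_cover)
      show "linked d r q ns \<or> length ns = 16 \<and> before d r T ns q"
        using assms(1) F by (auto simp: s full_chain_def)
      have "chain_points (ns, q) \<subseteq> stored s" using F chain_points_stored(1) s by simp
      then show "fst q \<in> space_R d" using in_chain_points(3) space by blast
      show "fst c \<in> space_R d \<and> fst y \<in> space_R d" if "(c, y) \<in> set ns" for c y
        using in_chain_points(1,2)[OF that] \<open>chain_points (ns, q) \<subseteq> stored s\<close> space by blast
    qed (use assms F in \<open>auto simp: s full_chain_def\<close>)
    moreover have "(before d r T ns x \<or> after d r T ns q x) \<and> tested d r T ns x" if "handles d r s x" for x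
      using that F by (simp add: s)
    ultimately show ?thesis by meson
  next
    case G
    have ch: "is_chain d r ns m" using assms(1) G by (auto simp: s full_chain_def)
    obtain y where "(origin ns, y) \<in> set ns" using origin_in[OF ch] by blast
    then have "origin ns \<in> stored s"
      using in_chain_points(1)[of "origin ns" y ns m] chain_points_stored(2)[of "(ns, m)"] G s by blast
    then have "fst (origin ns) \<in> space_R d" by (rule space)
    moreover have "edist d (fst (origin ns)) (fst x) \<le> cover_radius r" if x: "handles d r s x" "t < snd x" for x
    proof -
      have "compatible d r T (origin ns) x" using x G by (auto simp: s)
      \<comment> \<open>The origin may have expired by \<open>t\<close>; it suffices that it
        outlives \<open>T\<close>.\<close>
      moreover have "T < min (snd (origin ns)) (snd x)"
        using assms(1,3) G x by (auto simp: s)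
      ultimately have "edist d (fst (origin ns)) (fst x) \<le> r"
        unfolding compatible_def by (meson leD)
      with le_radius[OF assms(2)] show ?thesis by simp
    qed
    ultimately show ?thesis by blast
  next
    case none
    then show ?thesis
      by (intro bexI[of _ "\<lambda>_. 0"]) (auto simp: s space_R_def)
  qed
qed

section \<open>Raising the certified time\<close>

lemma compatible_mono: "compatible d r T a x \<Longrightarrow> T \<le> T' \<Longrightarrow> compatible d r T' a x"
  by (auto simp: compatible_def)

lemma before_mono: "before d r T ns x \<Longrightarrow> T \<le> T' \<Longrightarrow> before d r T' ns x"
  unfolding before_def by (blast intro: le_less_trans)

lemma after_mono: "after d r T ns q x \<Longrightarrow> T \<le> T' \<Longrightarrow> after d r T' ns q x"
  by (auto simp: after_def intro: compatible_mono)

lemma tested_mono: "tested d r T ns x \<Longrightarrow> T \<le> T' \<Longrightarrow> tested d r T' ns x"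
  unfolding tested_def using compatible_mono by blast

lemma testedI: "(\<And>p. p \<in> fst ` set ns \<Longrightarrow> compatible d r T p x) \<Longrightarrow> tested d r T ns x"
  unfolding tested_def by force

lemma finite_stored: "finite (stored s)"
  by (auto simp: stored_def chain_points_def)

lemma raised_cases:
  assumes "finite S"
  shows "raised d r S T x = T \<or>
    (\<exists>y\<in>S. raised d r S T x = min (snd x) (snd y) \<and> r < edist d (fst y) (fst x))"
proof -
  have "raised d r S T x \<in> insert T ((\<lambda>y. min (snd x) (snd y)) ` {y\<in>S. r < edist d (fst y) (fst x)})"
    unfolding raised_def using assms by (intro Max_in) auto
  then show ?thesis by blast
qed

lemma raised_ge: "finite S \<Longrightarrow> T \<le> raised d r S T x"
  by (simp add: raised_def)

lemma compatible_raised: "finite S \<Longrightarrow> y \<in> S \<Longrightarrow> compatible d r (raised d r S T x) y x"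
  unfolding compatible_def raised_def
  by (cases "r < edist d (fst y) (fst x)") (auto simp: min.commute intro!: Max_ge)

lemma certified_less: "certified d r X T \<Longrightarrow> \<forall>y\<in>X. snd y < u \<Longrightarrow> 0 < u \<Longrightarrow> T < u"
  by (auto simp: certified_def)

lemma certified_raised:
  assumes "certified d r X T" "finite S" "S \<subseteq> X"
  shows "certified d r (insert x X) (raised d r S T x)"
  using raised_cases[OF assms(2), of d r T x]
proof
  assume "raised d r S T x = T"
  with assms(1) show ?thesis by (auto simp: certified_def)
next
  assume "\<exists>y\<in>S. raised d r S T x = min (snd x) (snd y) \<and> r < edist d (fst y) (fst x)"
  then obtain y where y: "y \<in> X" "raised d r S T x = min (snd x) (snd y)" "r < edist d (fst y) (fst x)"
    using assms(3) by blast
  moreover have "min (snd x) (snd y) \<in> snd ` insert x X"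
    using y(1) by (auto simp: min_def)
  ultimately show ?thesis
    unfolding certified_def by (intro disjI2 conjI bexI[of _ y] bexI[of _ x]) auto
qed

lemma linked_self: "0 \<le> r \<Longrightarrow> linked d r x ((x, y) # ns)"
  by (simp add: linked_def edist_self)

lemma full_chain_single: "0 \<le> r \<Longrightarrow> full_chain d r [(x, x)] x"
  by (auto simp: full_chain_def intro: is_chain.base linked_self)

text \<open>The invariant is split along \<open>F\<close> and \<open>G\<close>, so that each case of
  \<open>level_step\<close> justifies only what it changes.\<close>

lemma level_invI:
  assumes "\<And>ns q. F = Some (ns, q) \<Longrightarrow> full_chain d r ns q \<and> snd (origin ns) \<le> T \<and> before d r T ns q"
    and "\<And>ns q x. F = Some (ns, q) \<Longrightarrow> x \<in> X \<Longrightarrow>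
      (before d r T ns x \<or> after d r T ns q x) \<and> tested d r T ns x"
    and "\<And>ns m. G = Some (ns, m) \<Longrightarrow> full_chain d r ns m \<and> T < snd (origin ns) \<and> frontier F < snd (origin ns)"
    and "\<And>ns m x. G = Some (ns, m) \<Longrightarrow> x \<in> X \<Longrightarrow> snd x \<le> snd m \<and> tested d r T ns x \<and>
      (frontier F < snd x \<longrightarrow> compatible d r T (origin ns) x)"
    and "\<And>x. G = None \<Longrightarrow> x \<in> X \<Longrightarrow> snd x \<le> frontier F"
    and "\<And>c. F = Some c \<Longrightarrow> chain_points c \<subseteq> X" "\<And>c. G = Some c \<Longrightarrow> chain_points c \<subseteq> X"
    and "certified d r X T"
  shows "level_inv d r X (T, F, G)"
proof -
  have "handles d r (T, F, G) x" if "x \<in> X" for x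
    unfolding handles.simps using assms(2,4,5)[OF _ that] by (cases F; cases G) auto
  moreover have "sound_level d r (T, F, G)"
    unfolding sound_level.simps using assms(1,3) by (cases F; cases G) auto
  moreover have "stored (T, F, G) \<subseteq> X"
    unfolding stored_def using assms(6,7) by auto
  ultimately show ?thesis using assms(8) by (simp add: level_inv_def)
qed

text \<open>At time \<open>T'\<close> the new item is compatible with every stored point, which
  gives it \<open>after\<close> and \<open>tested\<close>; the facts about old items persist because
  they are monotone in \<open>T\<close>. What remains is the bookkeeping of phases.\<close>

lemma level_inv_step:
  assumes inv: "level_inv d r X s" and r: "0 \<le> r"
  shows "level_inv d r (insert x X) (level_step d r s x)"
proof -
  obtain T F G where s: "s = (T, F, G)" by (cases s)
  define T' where "T' = raised d r (stored s) T x"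
  have TT: "T \<le> T'" unfolding T'_def by (intro raised_ge finite_stored)
  have comp: "compatible d r T' y x" if "y \<in> stored s" for y
    unfolding T'_def using that by (intro compatible_raised finite_stored)
  have sound: "sound_level d r (T, F, G)" and hand: "\<And>y. y \<in> X \<Longrightarrow> handles d r (T, F, G) y"
    and sub: "stored s \<subseteq> X" and cert: "certified d r X T"
    using inv by (auto simp: level_inv_def s)
  have cert': "certified d r (insert x X) T'"
    unfolding T'_def using cert finite_stored sub by (rule certified_raised)
  \<comment> \<open>Certified times come from expirations of earlier items, or are 0. Hence an item
    that outlives all others can open a phase whose origin is still alive after
    \<open>T'\<close>.\<close>
  have less: "T' < snd x" if "\<forall>y\<in>X. snd y < snd x" "0 < snd x"
    using raised_cases[OF finite_stored, of d r s T x] certified_less[OF cert that] sub that(1)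
    unfolding T'_def by (metis min_less_iff_disj subsetD)
  have oldF: "(before d r T' ns y \<or> after d r T' ns q y) \<and> tested d r T' ns y"
    if "F = Some (ns, q)" "y \<in> insert x X" for ns q y
  proof (cases "y = x")
    case True
    have "p \<in> stored s" if "p \<in> insert q (fst ` set ns \<union> snd ` set ns)" for p
      using that \<open>F = _\<close> by (auto simp: s stored_def chain_points_def)
    then have "compatible d r T' p x" if "p \<in> insert q (fst ` set ns \<union> snd ` set ns)" for p
      using comp that by blast
    then have "after d r T' ns q x \<and> tested d r T' ns x"
      unfolding after_def by (intro conjI ballI testedI) blast+
    with True show ?thesis by simp
  next
    case False
    with that have "(before d r T ns y \<or> after d r T ns q y) \<and> tested d r T ns y"
      using hand[of y] by simp
    then show ?thesis using TT before_mono after_mono tested_mono by blast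
  qed
  have sndF: "full_chain d r ns q \<and> snd (origin ns) \<le> T' \<and> before d r T' ns q"
    if "F = Some (ns, q)" for ns q
  proof -
    have "full_chain d r ns q \<and> snd (origin ns) \<le> T \<and> before d r T ns q"
      using sound that by simp
    then show ?thesis using TT before_mono order_trans by blast
  qed
  have oldG: "tested d r T' ns y" "frontier F < snd y \<Longrightarrow> compatible d r T' (origin ns) y"
    if "G = Some (ns, m)" "y \<in> insert x X" for ns m y
  proof -
    have ch: "is_chain d r ns m" using sound that by (auto simp: full_chain_def)
    obtain z where z: "(origin ns, z) \<in> set ns" using origin_in[OF ch] by blast
    have st: "p \<in> stored s" if "p \<in> fst ` set ns" for p
      using that \<open>G = _\<close> by (auto simp: s stored_def chain_points_def)
    have "origin ns \<in> fst ` set ns" using z by (metis fst_conv imageI)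
    then have new: "tested d r T' ns x" "compatible d r T' (origin ns) x"
      using comp st by (blast intro: testedI)+
    have "tested d r T ns y \<and> (frontier F < snd y \<longrightarrow> compatible d r T (origin ns) y)" if "y \<noteq> x"
      using hand[of y] that \<open>G = _\<close> \<open>y \<in> insert x X\<close> by simp
    then show "tested d r T' ns y" "frontier F < snd y \<Longrightarrow> compatible d r T' (origin ns) y"
      using new TT tested_mono compatible_mono by blast+
  qed
  have subF: "chain_points c \<subseteq> insert x X" if "F = Some c" for c
    using sub that by (auto simp: stored_def s)
  have subG: "chain_points c \<subseteq> insert x X" if "G = Some c" for c
    using sub that by (auto simp: stored_def s)
  have restart: "level_inv d r (insert x X) (T', H, Some ([(x, x)], x))"
    if H: "\<And>ns q. H = Some (ns, q) \<Longrightarrow> full_chain d r ns q \<and> snd (origin ns) \<le> T' \<and> before d r T' ns q"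
      "\<And>ns q y. H = Some (ns, q) \<Longrightarrow> y \<in> insert x X \<Longrightarrow>
        (before d r T' ns y \<or> after d r T' ns q y) \<and> tested d r T' ns y"
      "\<And>c. H = Some c \<Longrightarrow> chain_points c \<subseteq> insert x X"
      and E: "\<And>y. y \<in> X \<Longrightarrow> snd y \<le> frontier H" and new: "frontier H < snd x" for H
  proof (rule level_invI)
    have lt: "snd y < snd x" if "y \<in> X" for y using E[OF that] new by (rule le_less_trans)
    have "0 < snd x" using new by (rule le_less_trans[rotated]) simp
    then have "T' < snd x" using lt by (intro less) auto
    then show "full_chain d r ns m \<and> T' < snd (origin ns) \<and> frontier H < snd (origin ns)"
      if "Some ([(x, x)], x) = Some (ns, m)" for ns m
      using that new full_chain_single[OF r, of d x] by auto
    show "snd y \<le> snd m \<and> tested d r T' ns y \<and> (frontier H < snd y \<longrightarrow> compatible d r T' (origin ns) y)"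
      if "Some ([(x, x)], x) = Some (ns, m)" "y \<in> insert x X" for ns m y
    proof (cases "y = x")
      case True
      with that show ?thesis by (auto simp: tested_def compatible_def edist_self r)
    next
      case False
      with that(2) have "snd y < snd x" "\<not> frontier H < snd y" using lt[of y] E[of y] by auto
      with that(1) show ?thesis by (auto simp: tested_def less_imp_le)
    qed
  qed (use H cert' in \<open>auto simp: chain_points_def\<close>)
  show ?thesis
  proof (cases G)
    case None
    then have E: "snd y \<le> frontier F" if "y \<in> X" for y using hand[OF that] by simp
    show ?thesis
    proof (cases "snd x \<le> frontier F")
      case True
      then have st: "level_step d r s x = (T', F, None)"
        using None by (simp add: level_step_def s T'_def Let_def)
      show ?thesis
        unfolding st by (rule level_invI) (use sndF oldF E True subF cert' in auto)
    next
      case False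
      then have st: "level_step d r s x = (T', F, Some ([(x, x)], x))"
        using None by (simp add: level_step_def s T'_def Let_def)
      show ?thesis
        unfolding st using sndF oldF subF E False by (intro restart) (simp_all add: not_le)
    qed
  next
    case (Some c)
    obtain ns m where G: "G = Some (ns, m)" using Some by (cases c) auto
    have E: "snd y \<le> snd m" if "y \<in> X" for y using hand[OF that] G by simp
    have full: "full_chain d r ns m" and Tr: "T < snd (origin ns)" and Fr: "frontier F < snd (origin ns)"
      using sound G by simp_all
    have ch: "is_chain d r ns m" using full by (simp add: full_chain_def)
    have mX: "m \<in> X" using sub G by (simp add: s stored_def chain_points_def)
    consider (freeze) "snd (origin ns) \<le> T'" | (skip) "T' < snd (origin ns)" "snd x \<le> snd m"
      | (node) "T' < snd (origin ns)" "snd m < snd x" "length ns < 16" "\<not> linked d r x ns"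
      | (latest) "T' < snd (origin ns)" "snd m < snd x" "length ns < 16 \<longrightarrow> linked d r x ns"
      by (metis not_le)
    then show ?thesis
    proof cases
      case freeze
      \<comment> \<open>The old \<open>T\<close> is decisive: both the node and \<open>y\<close>
        outlive it, so \<open>compatible\<close> offers no excuse and the distance bound holds
        outright.\<close>
      have bef: "before d r T' ns y" if "y \<in> X" for y
        unfolding before_def
      proof (rule ballI, rule case_prodI2, rule impI)
        fix n c z assume n: "n \<in> set ns" "n = (c, z)" and lt: "snd z < snd y \<and> T' < snd y"
        have "tested d r T ns y" using hand[OF that] G by simp
        then have "compatible d r T c y"
          using n lt unfolding tested_def by fastforce
        moreover have "T < snd c"
          using Tr is_chain_bounds(1)[OF ch, of c z] n by simp
        moreover have "T < snd y" using TT lt by (auto intro: le_less_trans)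
        ultimately show "edist d (fst c) (fst y) \<le> r"
          by (auto simp: compatible_def min_le_iff_disj not_le[symmetric])
      qed
      have "y \<in> stored s" if "y \<in> insert m (snd ` set ns)" for y
        using G that by (auto simp: s stored_def chain_points_def)
      \<comment> \<open>The item that triggers the freezing counts as arriving after it.\<close>
      then have aft: "after d r T' ns m x"
        unfolding after_def using comp by blast
      have frozen: "(before d r T' ns y \<or> after d r T' ns m y) \<and> tested d r T' ns y"
        if "y \<in> insert x X" for y
        using bef aft oldG(1)[OF G] that by blast
      show ?thesis
      proof (cases "snd x \<le> snd m")
        case True
        have st: "level_step d r s x = (T', G, None)"
          using G freeze True by (simp add: level_step_def s T'_def Let_def)
        show ?thesis
          unfolding st
          by (rule level_invI) (use G freeze full bef mX frozen E True subG cert' in auto)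
      next
        case False
        then have st: "level_step d r s x = (T', G, Some ([(x, x)], x))"
          using G freeze by (simp add: level_step_def s T'_def Let_def)
        show ?thesis
          unfolding st
          by (rule restart) (use G freeze full bef mX frozen E False subG in auto)
      qed
    next
      case skip
      then have st: "level_step d r s x = (T', F, G)"
        using G by (simp add: level_step_def s T'_def Let_def)
      show ?thesis
        unfolding st
      proof (rule level_invI)
        show "snd y \<le> snd m' \<and> tested d r T' ns' y \<and>
            (frontier F < snd y \<longrightarrow> compatible d r T' (origin ns') y)"
          if "G = Some (ns', m')" "y \<in> insert x X" for ns' m' y
        proof -
          have "snd y \<le> snd m" using E[of y] skip(2) that(2) by blast
          with oldG[OF that] that(1) G show ?thesis by simp
        qed
      qed (use sndF oldF subF subG cert' skip full Fr G in auto)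
    next
      case node
      then have st: "level_step d r s x = (T', F, Some ((x, m) # ns, x))"
        using G by (auto simp: level_step_def s T'_def Let_def)
      \<comment> \<open>The room for another node guarantees that the previous latest item is
        linked, as the second component of a node must be.\<close>
      have "linked d r m ns" using full node(3) by (simp add: full_chain_def)
      then have "is_chain d r ((x, m) # ns) x"
        using ch node by (intro is_chain.step) auto
      then have full': "full_chain d r ((x, m) # ns) x"
        using node(3) linked_self[OF r] by (simp add: full_chain_def)
      have origin: "origin ((x, m) # ns) = origin ns" using is_chain_nonempty[OF ch] by simp
      show ?thesis
        unfolding st
      proof (rule level_invI)
        show "snd y \<le> snd m' \<and> tested d r T' ns' y \<and>
            (frontier F < snd y \<longrightarrow> compatible d r T' (origin ns') y)"
          if "Some ((x, m) # ns, x) = Some (ns', m')" "y \<in> insert x X" for ns' m' y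
        proof -
          have eq: "ns' = (x, m) # ns" "m' = x" using that by auto
          have "snd y \<le> snd x"
            using that(2) E[of y] node(2) by (auto intro: order_trans less_imp_le)
          moreover have "tested d r T' ((x, m) # ns) y"
          proof -
            \<comment> \<open>Only \<open>x\<close> outlives \<open>m\<close>, so the new node has
              to be compared with nothing but itself.\<close>
            have "compatible d r T' x y" if "snd m < snd y"
            proof -
              have "y = x" using \<open>y \<in> insert x X\<close> E[of y] that by auto
              then show ?thesis by (simp add: compatible_def edist_self r)
            qed
            with oldG(1)[OF G that(2)] show ?thesis by (simp add: tested_def)
          qed
          ultimately show ?thesis
            unfolding eq origin using oldG(2)[OF G that(2)] by simp
        qed
        show "full_chain d r ns' m' \<and> T' < snd (origin ns') \<and> frontier F < snd (origin ns')"
          if "Some ((x, m) # ns, x) = Some (ns', m')" for ns' m'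
        proof -
          have eq: "ns' = (x, m) # ns" "m' = x" using that by auto
          show ?thesis unfolding eq origin using full' node(1) Fr by simp
        qed
        show "chain_points c \<subseteq> insert x X" if "Some ((x, m) # ns, x) = Some c" for c
        proof -
          have "chain_points c \<subseteq> insert x (insert m (chain_points (ns, m)))"
            using that unfolding chain_points_def by (simp add: eq_commute[of _ c]) blast
          with subG[OF G] mX show ?thesis by blast
        qed
      qed (use sndF oldF subF cert' in auto)
    next
      case latest
      then have st: "level_step d r s x = (T', F, Some (ns, x))"
        using G by (auto simp: level_step_def s T'_def Let_def)
      have full': "full_chain d r ns x"
        using full latest is_chain_mono[OF ch, of x] by (simp add: full_chain_def)
      show ?thesis
        unfolding st
      proof (rule level_invI)
        show "snd y \<le> snd m' \<and> tested d r T' ns' y \<and>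
            (frontier F < snd y \<longrightarrow> compatible d r T' (origin ns') y)"
          if "Some (ns, x) = Some (ns', m')" "y \<in> insert x X" for ns' m' y
        proof -
          have "snd y \<le> snd x"
            using that(2) E[of y] latest(2) by (auto intro: order_trans less_imp_le)
          with oldG[OF G that(2)] that(1) show ?thesis by auto
        qed
        show "chain_points c \<subseteq> insert x X" if "Some (ns, x) = Some c" for c
        proof -
          have "chain_points c \<subseteq> insert x (chain_points (ns, m))"
            using that unfolding chain_points_def by (simp add: eq_commute[of _ c]) blast
          with subG[OF G] show ?thesis by blast
        qed
      qed (use full' latest Fr sndF oldF subF cert' in auto)
    qed
  qed
qed


section \<open>States as lists of words\<close>

text \<open>Self-delimiting codes: they stay decodable under concatenation, so \<open>inv\<close>
  recovers the levels from the list of words.\<close>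

definition prefix_code :: "('a \<Rightarrow> word list) \<Rightarrow> bool" where
  "prefix_code e \<longleftrightarrow> (\<forall>a b u v. e a @ u = e b @ v \<longrightarrow> a = b \<and> u = v)"

lemma prefix_codeD: "prefix_code e \<Longrightarrow> e a @ u = e b @ v \<Longrightarrow> a = b \<and> u = v"
  by (simp add: prefix_code_def)

lemma prefix_code_inj: "prefix_code e \<Longrightarrow> inj e"
  by (rule injI) (metis append.right_neutral prefix_codeD)

text \<open>The markers are counters with values 0 and 1 only, so a constant polynomial bounds
  them.\<close>

fun enc_list :: "('a \<Rightarrow> word list) \<Rightarrow> 'a list \<Rightarrow> word list" where
  "enc_list e [] = [Counter 0]"
| "enc_list e (x # xs) = Counter 1 # e x @ enc_list e xs"

fun enc_option :: "('a \<Rightarrow> word list) \<Rightarrow> 'a option \<Rightarrow> word list" where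
  "enc_option e None = [Counter 0]"
| "enc_option e (Some x) = Counter 1 # e x"

definition enc_pair :: "('a \<Rightarrow> word list) \<Rightarrow> ('b \<Rightarrow> word list) \<Rightarrow> 'a \<times> 'b \<Rightarrow> word list" where
  "enc_pair e f p = e (fst p) @ f (snd p)"

definition enc_spoint :: "spoint \<Rightarrow> word list" where
  "enc_spoint p = [Point (fst p), Time (snd p)]"

text \<open>The initial value \<open>0\<close> need not be a time that occurs in the stream, so it is coded by a counter.\<close>

definition enc_time :: "enat \<Rightarrow> word list" where
  "enc_time T = (if T = 0 then [Counter 0] else [Time T])"

definition enc_chain :: "chain \<Rightarrow> word list" where
  "enc_chain = enc_pair (enc_list (enc_pair enc_spoint enc_spoint)) enc_spoint"

definition enc_level :: "level \<Rightarrow> word list" where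
  "enc_level = enc_pair enc_time (enc_pair (enc_option enc_chain) (enc_option enc_chain))"

lemma prefix_code_list:
  assumes "prefix_code e"
  shows "prefix_code (enc_list e)"
proof -
  have "enc_list e xs @ u = enc_list e ys @ v \<longrightarrow> xs = ys \<and> u = v" for xs ys u v
  proof (induction xs arbitrary: ys)
    case Nil
    then show ?case by (cases ys) auto
  next
    case (Cons x xs)
    then show ?case by (cases ys) (auto dest!: prefix_codeD[OF assms])
  qed
  then show ?thesis by (simp add: prefix_code_def)
qed

lemma prefix_code_option:
  assumes "prefix_code e"
  shows "prefix_code (enc_option e)"
proof -
  have "enc_option e a @ u = enc_option e b @ v \<longrightarrow> a = b \<and> u = v" for a b u v
    by (cases a; cases b) (auto dest!: prefix_codeD[OF assms])
  then show ?thesis by (simp add: prefix_code_def)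
qed

lemma prefix_code_pair:
  assumes "prefix_code e" "prefix_code f"
  shows "prefix_code (enc_pair e f)"
  unfolding prefix_code_def enc_pair_def
  by (auto simp: prod_eq_iff dest!: prefix_codeD[OF assms(1)] prefix_codeD[OF assms(2)])

lemma prefix_code_level: "prefix_code enc_level"
  unfolding enc_level_def enc_chain_def
  by (intro prefix_code_pair prefix_code_option prefix_code_list)
     (auto simp: prefix_code_def enc_spoint_def enc_time_def prod_eq_iff)

abbreviation enc_state :: "level list \<Rightarrow> word list" where
  "enc_state \<equiv> enc_list enc_level"

lemma inv_enc_state: "inv enc_state (enc_state ss) = ss"
  by (intro inv_f_f prefix_code_inj prefix_code_list prefix_code_level)

lemma length_enc_list:
  "(\<And>x. x \<in> set xs \<Longrightarrow> length (e x) \<le> k) \<Longrightarrow> length (enc_list e xs) \<le> Suc k * length xs + 1"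
  by (induction xs) force+

lemma set_enc_list: "set (enc_list e xs) \<subseteq> {Counter 0, Counter 1} \<union> (\<Union>x\<in>set xs. set (e x))"
  by (induction xs) auto

text \<open>Each of at most 16 nodes takes a marker and four words, then come the end marker and two
  words for \<open>q\<close>: 5 * 16 + 1 + 2 = 83.\<close>

lemma length_enc_chain: "full_chain d r ns q \<Longrightarrow> length (enc_chain (ns, q)) \<le> 83"
  using length_enc_list[of ns "enc_pair enc_spoint enc_spoint" 4]
  by (simp add: enc_chain_def enc_pair_def enc_spoint_def full_chain_def)

lemma length_enc_level: "sound_level d r s \<Longrightarrow> length (enc_level s) \<le> 169"
proof -
  assume sound: "sound_level d r s"
  obtain T F G where s: "s = (T, F, G)" by (cases s)
  have "length (enc_option enc_chain H) \<le> 84" if "\<forall>(ns, q)\<in>set_option H. full_chain d r ns q" for H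
    using that length_enc_chain by (cases H) auto
  from this[of F] this[of G] sound show ?thesis
    by (auto simp: s enc_level_def enc_pair_def enc_time_def case_prod_beta)
qed

lemma set_enc_spoint: "p \<in> P \<Longrightarrow> set (enc_spoint p) \<subseteq> (Point \<circ> fst) ` P \<union> (Time \<circ> snd) ` P"
  by (simp add: enc_spoint_def image_iff) blast

lemma set_enc_chain:
  "set (enc_chain c) \<subseteq> {Counter 0, Counter 1} \<union> (Point \<circ> fst) ` chain_points c \<union> (Time \<circ> snd) ` chain_points c"
  (is "_ \<subseteq> ?R")
proof -
  have "set (enc_pair enc_spoint enc_spoint n) \<subseteq> ?R" if "n \<in> set (fst c)" for n
  proof -
    have "fst n \<in> chain_points c" "snd n \<in> chain_points c"
      using that by (simp_all add: chain_points_def)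
    from this[THEN set_enc_spoint] show ?thesis unfolding enc_pair_def set_append by blast
  qed
  then have "set (enc_list (enc_pair enc_spoint enc_spoint) (fst c)) \<subseteq> ?R"
    using set_enc_list[of "enc_pair enc_spoint enc_spoint" "fst c"] by blast
  moreover have "set (enc_spoint (snd c)) \<subseteq> ?R"
    using set_enc_spoint[of "snd c" "chain_points c"] by (auto simp: chain_points_def)
  ultimately show ?thesis by (simp add: enc_chain_def enc_pair_def)
qed

lemma set_enc_level:
  "set (enc_level s) \<subseteq> {Counter 0, Counter 1} \<union> (if fst s = 0 then {} else {Time (fst s)}) \<union>
     (Point \<circ> fst) ` stored s \<union> (Time \<circ> snd) ` stored s"
proof -
  obtain T F G where s: "s = (T, F, G)" by (cases s)
  have "set (enc_option enc_chain H) \<subseteq> {Counter 0, Counter 1} \<union> (Point \<circ> fst) ` stored s \<union>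
      (Time \<circ> snd) ` stored s" if "H = F \<or> H = G" for H
  proof (cases H)
    case (Some c)
    with that have "chain_points c \<subseteq> stored s"
      using chain_points_stored s by blast
    with set_enc_chain[of c] show ?thesis using Some by fastforce
  qed simp
  then show ?thesis
    by (auto simp: s enc_level_def enc_pair_def enc_time_def)
qed

section \<open>The algorithm\<close>

text \<open>All items have arrived by the query time, so the expiration decides whether an item is
  active.\<close>

definition spoint :: "item \<Rightarrow> spoint" where
  "spoint x = (pnt x, expi x)"

definition levels_step :: "nat \<Rightarrow> real list \<Rightarrow> level list \<Rightarrow> item \<Rightarrow> level list" where
  "levels_step d rs ss x = map2 (\<lambda>r s. level_step d r s (spoint x)) rs ss"

definition levels_after :: "nat \<Rightarrow> real list \<Rightarrow> item list \<Rightarrow> level list" where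
  "levels_after d rs xs = foldl (levels_step d rs) (map (\<lambda>_. (0, None, None)) rs) xs"

text \<open>
  What is known about an item is a condition on that item alone, so the centre may be chosen as one
  that is good for all conceivable items satisfying it.
\<close>

definition meb_query :: "nat \<Rightarrow> real list \<Rightarrow> level list \<Rightarrow> nat \<Rightarrow> point \<times> real" where
  "meb_query d rs ss t =
    (let k = LEAST k. fst (ss ! k) \<le> enat t in
      (SOME p. p \<in> space_R d \<and>
         (\<forall>x. handles d (rs ! k) (ss ! k) x \<and> enat t < snd x \<longrightarrow> edist d p (fst x) \<le> cover_radius (rs ! k)),
       cover_radius (rs ! k)))"

definition meb_alg :: "nat \<Rightarrow> real list \<Rightarrow> stream_alg" where
  "meb_alg d rs =
    \<lparr>initial = enc_state (levels_after d rs []),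
     update = \<lambda>ws x. enc_state (levels_step d rs (inv enc_state ws) x),
     query = \<lambda>ws t. meb_query d rs (inv enc_state ws) t\<rparr>"

lemma levels_after_snoc: "levels_after d rs (xs @ [x]) = levels_step d rs (levels_after d rs xs) x"
  by (simp add: levels_after_def)

lemma state_after_meb_alg: "state_after (meb_alg d rs) xs = enc_state (levels_after d rs xs)"
  unfolding state_after_def
  by (induction xs rule: rev_induct) (simp_all add: meb_alg_def inv_enc_state levels_after_snoc)

lemma levels_after_inv:
  assumes "\<And>r. r \<in> set rs \<Longrightarrow> 0 \<le> r"
  shows "length (levels_after d rs xs) = length rs \<and>
    (\<forall>k<length rs. level_inv d (rs ! k) (spoint ` set xs) (levels_after d rs xs ! k))"
proof (induction xs rule: rev_induct)
  case Nil
  then show ?case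
    by (simp add: levels_after_def level_inv_def stored_def certified_def)
next
  case (snoc x xs)
  then show ?case
    using assms by (simp add: levels_after_snoc levels_step_def level_inv_step)
qed

text \<open>Legality follows from the invariant, which ties stored points and certified times to
  items of the stream. A level takes at most 169 words and a marker.\<close>

lemma meb_alg_space:
  assumes "\<And>r. r \<in> set rs \<Longrightarrow> 0 \<le> r" "171 * real (length rs + 1) \<le> B"
  shows "uses_space d \<Delta> [:1:] (meb_alg d rs) B"
  unfolding uses_space_def
proof (intro allI impI conjI ballI)
  fix xs
  define ss where "ss = levels_after d rs xs"
  have len: "length ss = length rs"
    and inv: "\<And>k. k < length rs \<Longrightarrow> level_inv d (rs ! k) (spoint ` set xs) (ss ! k)"
    using levels_after_inv[of rs d xs, OF assms(1)] by (auto simp: ss_def)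
  have inv': "\<exists>r. level_inv d r (spoint ` set xs) s" if "s \<in> set ss" for s
    using that inv len by (metis in_set_conv_nth)
  have "length (enc_state ss) \<le> Suc 169 * length ss + 1"
    by (intro length_enc_list) (use inv' length_enc_level level_inv_def in blast)
  then have "real (length (enc_state ss)) \<le> 171 * real (length rs + 1)"
    by (simp add: len)
  then show "real (length (state_after (meb_alg d rs) xs)) \<le> B"
    using assms(2) by (simp add: state_after_meb_alg ss_def)
  fix w assume "w \<in> set (state_after (meb_alg d rs) xs)"
  then consider "w \<in> {Counter 0, Counter 1}" | s where "s \<in> set ss" "w \<in> set (enc_level s)"
    using set_enc_list[of enc_level ss] by (auto simp: state_after_meb_alg ss_def)
  then show "legal_word [:1:] xs w"
  proof cases
    case 2
    obtain r where "level_inv d r (spoint ` set xs) s" using inv'[OF 2(1)] by blast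
    then have st: "stored s \<subseteq> spoint ` set xs" and T: "fst s = 0 \<or> fst s \<in> snd ` spoint ` set xs"
      by (auto simp: level_inv_def certified_def)
    have "w \<in> {Counter 0, Counter 1} \<union> (if fst s = 0 then {} else {Time (fst s)}) \<union>
        (Point \<circ> fst) ` stored s \<union> (Time \<circ> snd) ` stored s"
      using set_enc_level 2(2) by (rule subsetD)
    then show ?thesis
    proof (elim UnE)
      assume "w \<in> (if fst s = 0 then {} else {Time (fst s)})"
      then have "w = Time (fst s)" "fst s \<in> snd ` spoint ` set xs"
        using T by (simp_all split: if_splits)
      then show ?thesis by (auto simp: spoint_def)
    next
      assume "w \<in> (Point \<circ> fst) ` stored s"
      then obtain p where p: "p \<in> stored s" "w = Point (fst p)" by auto
      then obtain x where "x \<in> set xs" "p = spoint x" using st by blast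
      with p(2) show ?thesis by (auto simp: spoint_def)
    next
      assume "w \<in> (Time \<circ> snd) ` stored s"
      then obtain p where p: "p \<in> stored s" "w = Time (snd p)" by auto
      then obtain x where "x \<in> set xs" "p = spoint x" using st by blast
      with p(2) show ?thesis by (auto simp: spoint_def)
    qed auto
  qed auto
qed

section \<open>Approximation guarantee\<close>

lemma half_dist_le_meb_radius:
  assumes "P \<subseteq> space_R d" "a \<in> P" "b \<in> P" "\<And>x. x \<in> P \<Longrightarrow> edist d a x \<le> D"
  shows "edist d a b / 2 \<le> meb_radius d P"
  unfolding meb_radius_def
proof (rule cInf_greatest)
  \<comment> \<open>The bound \<open>D\<close> makes a ball around \<open>a\<close> admissible, so
    the infimum ranges over a nonempty set.\<close>
  have "0 \<le> D" using assms(4)[OF assms(2)] by (simp add: edist_self)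
  then have "D \<in> {r. 0 \<le> r \<and> (\<exists>c\<in>space_R d. P \<subseteq> eball d c r)}"
    using assms by (auto simp: eball_def)
  then show "{r. 0 \<le> r \<and> (\<exists>c\<in>space_R d. P \<subseteq> eball d c r)} \<noteq> {}" by blast
next
  fix r assume "r \<in> {r. 0 \<le> r \<and> (\<exists>c\<in>space_R d. P \<subseteq> eball d c r)}"
  then obtain c where "edist d c a \<le> r" "edist d c b \<le> r"
    using assms(2,3) by (auto simp: eball_def)
  then show "edist d a b / 2 \<le> r"
    using edist_triangle[of d a b c] by (simp add: edist_commute[of d a c])
qed

text \<open>The scale before the chosen one is certified beyond \<open>t\<close>, so two active
  items are farther apart than its distance. Half their distance bounds the optimum from below, and
  consecutive positive scales differ by the factor \<open>1 + \<eta>\<close>.\<close>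

lemma meb_alg_approx:
  fixes \<eta> :: real
  assumes "0 < \<eta>" "1 < \<Delta>" "\<Delta> \<le> (1 + \<eta>) ^ n" "(1 + sqrt 3) * (1 + \<eta>) \<le> \<alpha>"
  defines "rs \<equiv> 0 # map (\<lambda>i. (1 + \<eta>) ^ i) [0..<Suc n]"
  shows "maintains_meb d \<Delta> (meb_alg d rs) \<alpha>"
  unfolding maintains_meb_def
proof (intro allI impI)
  fix xs t assume asm: "expiration_stream d \<Delta> xs \<and> (\<forall>x\<in>set xs. ins x \<le> t)"
  define ss where "ss = levels_after d rs xs"
  define X where "X = spoint ` set xs"
  have rs0: "0 \<le> r" if "r \<in> set rs" for r
    using that assms(1) by (auto simp: rs_def)
  have len: "length rs = n + 2" by (simp add: rs_def)
  have inv: "level_inv d (rs ! k) X (ss ! k)" if "k < n + 2" for k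
    using levels_after_inv[of rs d xs, OF rs0] that by (simp add: ss_def X_def len)
  have nth: "rs ! Suc i = (1 + \<eta>) ^ i" if "i \<le> n" for i
    using that by (simp add: rs_def less_Suc_eq_le del: upt_Suc)
  have le\<Delta>: "edist d (fst a) (fst b) \<le> \<Delta>" if "a \<in> X" "b \<in> X" for a b
  proof (cases "fst a = fst b")
    case True
    then show ?thesis using assms(2) by (simp add: edist_self)
  next
    case False
    with that asm show ?thesis by (auto simp: X_def spoint_def expiration_stream_def)
  qed
  have ge1: "1 \<le> edist d (fst a) (fst b)" if "a \<in> X" "b \<in> X" "0 < edist d (fst a) (fst b)" for a b
  proof -
    have "fst a \<noteq> fst b" using that(3) by (auto simp: edist_self)
    with that(1,2) asm show ?thesis by (auto simp: X_def spoint_def expiration_stream_def)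
  qed
  have active: "active_points xs t = fst ` {a \<in> X. enat t < snd a}"
    using asm by (force simp: active_points_def X_def spoint_def)
  have space: "fst a \<in> space_R d" if "a \<in> X" for a
    using that asm by (auto simp: X_def spoint_def expiration_stream_def)
  define k where "k = (LEAST k. fst (ss ! k) \<le> enat t)"
  \<comment> \<open>No two items are farther apart than the largest scale, so its certified time is
    still 0 and the least index exists.\<close>
  have top: "fst (ss ! Suc n) \<le> enat t"
  proof (rule ccontr)
    assume "\<not> ?thesis"
    then have "fst (ss ! Suc n) \<noteq> 0" by auto
    then obtain a b where "a \<in> X" "b \<in> X" "rs ! Suc n < edist d (fst a) (fst b)"
      using inv[of "Suc n"] by (auto simp: level_inv_def certified_def)
    with le\<Delta>[of a b] assms(3) nth[of n] show False by simp
  qed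
  have k: "fst (ss ! k) \<le> enat t" "k < n + 2"
    unfolding k_def using LeastI[of "\<lambda>k. fst (ss ! k) \<le> enat t", OF top]
      Least_le[of "\<lambda>k. fst (ss ! k) \<le> enat t", OF top] by simp_all
  have rk: "0 \<le> rs ! k" using rs0 k(2) len by simp
  let ?ok = "\<lambda>p. p \<in> space_R d \<and>
    (\<forall>x. handles d (rs ! k) (ss ! k) x \<and> enat t < snd x \<longrightarrow> edist d p (fst x) \<le> cover_radius (rs ! k))"
  have "\<exists>p\<in>space_R d. \<forall>x. handles d (rs ! k) (ss ! k) x \<and> enat t < snd x \<longrightarrow>
    edist d p (fst x) \<le> cover_radius (rs ! k)"
    using inv[OF k(2)] space by (intro level_cover k(1) rk) (auto simp: level_inv_def)
  then have "?ok (SOME p. ?ok p)" by (intro someI_ex[of ?ok]) blast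
  moreover define c where "c = (SOME p. ?ok p)"
  ultimately have c: "?ok c" by simp
  have query: "query (meb_alg d rs) (state_after (meb_alg d rs) xs) t = (c, cover_radius (rs ! k))"
  proof -
    have "query (meb_alg d rs) (state_after (meb_alg d rs) xs) t = meb_query d rs ss t"
      unfolding state_after_meb_alg by (simp add: meb_alg_def inv_enc_state ss_def)
    also have "\<dots> = (c, cover_radius (rs ! k))"
      by (simp only: meb_query_def Let_def c_def k_def)
    finally show ?thesis .
  qed
  have cover: "active_points xs t \<subseteq> eball d c (cover_radius (rs ! k))"
  proof
    fix p assume "p \<in> active_points xs t"
    then obtain a where a: "a \<in> X" "enat t < snd a" "p = fst a" by (auto simp: active)
    have "handles d (rs ! k) (ss ! k) a" using inv[OF k(2)] a(1) by (simp add: level_inv_def)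
    with a c have "edist d c p \<le> cover_radius (rs ! k)" by blast
    with space a show "p \<in> eball d c (cover_radius (rs ! k))" by (simp add: eball_def)
  qed
  have half: "edist d (fst a) (fst b) / 2 \<le> meb_radius d (active_points xs t)"
    if ab: "a \<in> X" "b \<in> X" "enat t < snd a" "enat t < snd b" for a b
  proof (rule half_dist_le_meb_radius)
    show "active_points xs t \<subseteq> space_R d" unfolding active using space by blast
    show "fst a \<in> active_points xs t" "fst b \<in> active_points xs t" using ab by (simp_all add: active)
    show "edist d (fst a) x \<le> \<Delta>" if "x \<in> active_points xs t" for x
      using that le\<Delta>[OF ab(1)] unfolding active by blast
  qed
  have "0 < (1 + sqrt 3) * (1 + \<eta>)" using assms(1) by (intro mult_pos_pos add_pos_pos) auto
  with assms(4) have "0 \<le> \<alpha>" by linarith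
  have meb: "cover_radius (rs ! k) \<le> \<alpha> * meb_radius d (active_points xs t)" if ne: "active_points xs t \<noteq> {}"
  proof (cases k)
    case 0
    obtain a where a: "a \<in> X" "enat t < snd a" using ne by (auto simp: active)
    then have "edist d (fst a) (fst a) / 2 \<le> meb_radius d (active_points xs t)"
      by (intro half)
    with \<open>0 \<le> \<alpha>\<close> show ?thesis using 0 by (simp add: rs_def edist_self)
  next
    case (Suc i)
    have "enat t < fst (ss ! i)"
      using not_less_Least[of i "\<lambda>k. fst (ss ! k) \<le> enat t"] Suc by (simp add: k_def not_le)
    moreover from this have "fst (ss ! i) \<noteq> 0" by auto
    ultimately obtain a b where ab: "a \<in> X" "b \<in> X" "enat t < snd a" "enat t < snd b"
      "rs ! i < edist d (fst a) (fst b)"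
      using inv[of i] Suc k(2) by (auto simp: level_inv_def certified_def intro: less_le_trans)
    let ?D = "edist d (fst a) (fst b)"
    have "0 < ?D" using ab(5) rs0[of "rs ! i"] Suc k(2) len by (simp add: le_less_trans)
    then have "1 \<le> ?D" using ge1 ab by blast
    \<comment> \<open>Between the scales 0 and 1 there is no finite ratio; there the minimum
      distance 1 of distinct points is used.\<close>
    have "rs ! k \<le> (1 + \<eta>) * ?D"
    proof (cases i)
      case 0
      have "1 * 1 \<le> (1 + \<eta>) * ?D"
        using \<open>1 \<le> ?D\<close> assms(1) by (intro mult_mono) auto
      with 0 Suc nth[of 0] show ?thesis by simp
    next
      case (Suc j)
      then have "rs ! k = (1 + \<eta>) * rs ! i"
        using nth[of j] nth[of i] \<open>k = Suc i\<close> k(2) by simp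
      with ab(5) assms(1) show ?thesis by simp
    qed
    then have "cover_radius (rs ! k) \<le> (1 + sqrt 3) / 2 * ((1 + \<eta>) * ?D)"
      by (intro mult_left_mono) auto
    also have "\<dots> = ((1 + sqrt 3) * (1 + \<eta>)) * (?D / 2)" by simp
    also have "\<dots> \<le> \<alpha> * (?D / 2)"
      using assms(4) edist_nonneg by (intro mult_right_mono) auto
    also have "\<dots> \<le> \<alpha> * meb_radius d (active_points xs t)"
      using \<open>0 \<le> \<alpha>\<close> ab by (intro mult_left_mono half)
    finally show ?thesis .
  qed
  show "case query (meb_alg d rs) (state_after (meb_alg d rs) xs) t of (c, \<rho>) \<Rightarrow>
    c \<in> space_R d \<and> 0 \<le> \<rho> \<and> active_points xs t \<subseteq> eball d c \<rho> \<and>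
    (active_points xs t \<noteq> {} \<longrightarrow> \<rho> \<le> \<alpha> * meb_radius d (active_points xs t))"
    unfolding query using c cover meb rk by simp
qed

section \<open>Number of scales\<close>

lemma level_count:
  fixes \<epsilon>0 \<Delta>0 \<epsilon> \<Delta> :: real
  assumes "1 < \<Delta>0" "0 < \<epsilon>" "\<epsilon> \<le> \<epsilon>0" "\<Delta>0 \<le> \<Delta>"
  obtains n where "\<Delta> \<le> (1 + \<epsilon> / 3) ^ n"
    "real (n + 3) \<le> (3 + \<epsilon>0 + 4 * \<epsilon>0 / ln \<Delta>0) * (1 / \<epsilon> * ln \<Delta>)"
proof
  define \<eta> where "\<eta> = \<epsilon> / 3"
  have \<eta>: "0 < \<eta>" using assms by (simp add: \<eta>_def)
  have ln\<Delta>: "0 < ln \<Delta>0" "ln \<Delta>0 \<le> ln \<Delta>" using assms by simp_all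
  \<comment> \<open>Applied to the reciprocal, the bound on \<open>ln\<close> from above becomes one
    from below for \<open>ln (1 + \<eta>)\<close>.\<close>
  have "ln (1 / (1 + \<eta>)) \<le> 1 / (1 + \<eta>) - 1" using \<eta> by (intro ln_le_minus_one) simp
  then have ln\<eta>: "\<eta> / (1 + \<eta>) \<le> ln (1 + \<eta>)"
    using \<eta> by (simp add: ln_div field_simps)
  have pos: "0 < ln (1 + \<eta>)" using \<eta> by simp
  define n where "n = nat \<lceil>ln \<Delta> / ln (1 + \<eta>)\<rceil>"
  have "0 \<le> ln \<Delta> / ln (1 + \<eta>)" using ln\<Delta> pos by simp
  then have n: "ln \<Delta> / ln (1 + \<eta>) \<le> real n" "real n \<le> ln \<Delta> / ln (1 + \<eta>) + 1"
    unfolding n_def by linarith+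
  have "ln \<Delta> \<le> real n * ln (1 + \<eta>)" using n(1) pos by (simp add: field_simps)
  also have "\<dots> = ln ((1 + \<eta>) ^ n)" using \<eta> by (simp add: ln_realpow)
  finally show "\<Delta> \<le> (1 + \<epsilon> / 3) ^ n"
    using assms \<eta> by (simp add: \<eta>_def[symmetric])
  have "ln \<Delta> / ln (1 + \<eta>) \<le> ln \<Delta> / (\<eta> / (1 + \<eta>))"
    using ln\<eta> ln\<Delta> \<eta> pos by (intro divide_left_mono) auto
  also have "\<dots> = (3 + \<epsilon>) * (1 / \<epsilon> * ln \<Delta>)"
    using assms by (simp add: \<eta>_def field_simps)
  also have "\<dots> \<le> (3 + \<epsilon>0) * (1 / \<epsilon> * ln \<Delta>)"
    using assms ln\<Delta> by (intro mult_right_mono) auto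
  finally have main: "ln \<Delta> / ln (1 + \<eta>) \<le> (3 + \<epsilon>0) * (1 / \<epsilon> * ln \<Delta>)" .
  \<comment> \<open>The additive 4, one from rounding up and three from \<open>n + 3\<close>, is
    absorbed because \<open>1 / \<epsilon> * ln \<Delta>\<close> is at least
    \<open>ln \<Delta>0 / \<epsilon>0\<close>.\<close>
  have "1 * 1 \<le> (\<epsilon>0 / \<epsilon>) * (ln \<Delta> / ln \<Delta>0)"
    using assms ln\<Delta> by (intro mult_mono) auto
  moreover have "4 * \<epsilon>0 / ln \<Delta>0 * (1 / \<epsilon> * ln \<Delta>) = 4 * ((\<epsilon>0 / \<epsilon>) * (ln \<Delta> / ln \<Delta>0))"
    by (simp add: ac_simps)
  ultimately have "4 \<le> 4 * \<epsilon>0 / ln \<Delta>0 * (1 / \<epsilon> * ln \<Delta>)" by linarith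
  with main n(2) have "real (n + 3) \<le>
      (3 + \<epsilon>0) * (1 / \<epsilon> * ln \<Delta>) + 4 * \<epsilon>0 / ln \<Delta>0 * (1 / \<epsilon> * ln \<Delta>)"
    by linarith
  then show "real (n + 3) \<le> (3 + \<epsilon>0 + 4 * \<epsilon>0 / ln \<Delta>0) * (1 / \<epsilon> * ln \<Delta>)"
    by (simp only: distrib_right)
qed

theorem theorem3p6:
  fixes \<epsilon>0 \<Delta>0 :: real
  assumes "0 < \<epsilon>0" and "1 < \<Delta>0"
  shows "\<exists>(C::real) (q::nat poly). \<forall>(d::nat) (\<epsilon>::real) (\<Delta>::real).
           0 < \<epsilon> \<and> \<epsilon> \<le> \<epsilon>0 \<and> \<Delta>0 \<le> \<Delta> \<longrightarrow>
           (\<exists>A. uses_space d \<Delta> q A (C * ((1 / \<epsilon>) * ln \<Delta>)) \<and>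
                maintains_meb d \<Delta> A (1 + sqrt 3 + \<epsilon>))"
proof (rule exI, rule exI, intro allI impI)
  fix d \<epsilon> \<Delta> assume asm: "0 < \<epsilon> \<and> \<epsilon> \<le> \<epsilon>0 \<and> \<Delta>0 \<le> \<Delta>"
  obtain n where n: "\<Delta> \<le> (1 + \<epsilon> / 3) ^ n"
    "real (n + 3) \<le> (3 + \<epsilon>0 + 4 * \<epsilon>0 / ln \<Delta>0) * (1 / \<epsilon> * ln \<Delta>)"
    using level_count[OF assms(2)] asm by blast
  define rs where "rs = 0 # map (\<lambda>i. (1 + \<epsilon> / 3) ^ i) [0..<Suc n]"
  \<comment> \<open>This is why the ratio \<open>1 + \<epsilon> / 3\<close> is fine enough: the
    factor \<open>1 + sqrt 3\<close> is at most 3.\<close>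
  have "sqrt 3 \<le> 2" by (rule real_le_lsqrt) auto
  then have "(1 + sqrt 3) * \<epsilon> \<le> 3 * \<epsilon>" using asm by (intro mult_right_mono) auto
  then have "(1 + sqrt 3) * (1 + \<epsilon> / 3) \<le> 1 + sqrt 3 + \<epsilon>" by (simp add: algebra_simps)
  then have "maintains_meb d \<Delta> (meb_alg d rs) (1 + sqrt 3 + \<epsilon>)"
    unfolding rs_def using asm assms n(1) by (intro meb_alg_approx) auto
  moreover have "uses_space d \<Delta> [:1:] (meb_alg d rs)
      (171 * (3 + \<epsilon>0 + 4 * \<epsilon>0 / ln \<Delta>0) * (1 / \<epsilon> * ln \<Delta>))"
  proof (rule meb_alg_space)
    show "0 \<le> r" if "r \<in> set rs" for r using that asm by (auto simp: rs_def)
    have "real (length rs + 1) = real (n + 3)" by (simp add: rs_def)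
    with n(2) show "171 * real (length rs + 1) \<le>
      171 * (3 + \<epsilon>0 + 4 * \<epsilon>0 / ln \<Delta>0) * (1 / \<epsilon> * ln \<Delta>)"
      by (simp only: mult.assoc) (intro mult_left_mono, auto)
  qed
  ultimately show "\<exists>A. uses_space d \<Delta> [:1:] A
      (171 * (3 + \<epsilon>0 + 4 * \<epsilon>0 / ln \<Delta>0) * ((1 / \<epsilon>) * ln \<Delta>)) \<and>
    maintains_meb d \<Delta> A (1 + sqrt 3 + \<epsilon>)" by blast
qed

end
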